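(* Let $s\in(0,1)$, and let $L$ be any operator as described in the context, with $K$ possibly being a measure. Let $u$ be any bounded weak solution of $Lu=0$ in $\mathbb R^n$. Then $u$ is constant.
   Context: **Operators.** $K\in L^1_{\rm loc}(\mathbb R^n\setminus\{0\})$ is nonnegative and positively homogeneous of degree $-n-2s$; if $s=\frac12$, moreover $\int_{\partial B_1}y\,K(y)\,d\mathcal H^{n-1}(y)=0$. For constants $\Lambda\ge\lambda>0$, $$0<\lambda\le\inf_{\nu\in S^{n-1}}\int_{S^{n-1}}|\nu\cdot\theta|^{2s}K(\theta)\,d\theta,\qquad \int_{S^{n-1}}K(\theta)\,d\theta\le\Lambda,$$ and $b\in\mathbb R^n$ with $|b|\le\Lambda$ when $s=\frac12$. The operator is $$Lu(x)=\begin{cases}\int_{\mathbb R^n}(u(x)-u(x+y))K(y)\,dy & s\in(0,\frac12),\\ \mathrm{P.V.}\int_{\mathbb R^n}(u(x)-u(x+y))K(y)\,dy+b\cdot\nabla u(x)& s=\frac12,\\ \int_{\mathbb R^n}(u(x)-u(x+y)+\nabla u(x)\cdot y)K(y)\,dy& s\in(\frac12,1).\end{cases}$$ "$K$ possibly a measure" means that $K(y)\,dy$ may be replaced by a nonnegative $(-n-2s)$-homogeneous Radon measure on $\mathbb R^n\setminus\{0\}$, i.e. of the form $r^{-1-2s}\,dr\,d\kappa(\theta)$ in polar coordinates $y=r\theta$ with $\kappa$ a finite nonnegative measure on $S^{n-1}$, with $K(\theta)\,d\theta$ replaced by $d\kappa(\theta)$ in the conditions above. **Adjoint and weak solutions.**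 $L^*$ is the operator of the same form with $K$ replaced by its reflection $K(-\,\cdot)$ and $b$ by $-b$. $Lu=f$ in an open set $\Omega$ weakly means $\int_{\mathbb R^n}u\,L^*\eta\,dx=\int_\Omega f\eta\,dx$ for every $\eta\in C_c^\infty(\Omega)$. *)

theory Defs
  imports "HOL-Analysis.Analysis"
begin

(* A finite measure kappa on the unit sphere represents the kernel
   r^(-1-2s) dr dkappa(theta), y = r theta.  A kernel K(y) dy with K locally integrable on
   R^n - {0}, nonnegative and homogeneous of degree -n-2s is the case
   dkappa = K dH^(n-1) on the sphere. *)
definition sphere_borel :: "'a::euclidean_space measure" where
  "sphere_borel = restrict_space borel (sphere 0 1)"

definition kernel_measure :: "real \<Rightarrow> 'a::euclidean_space measure \<Rightarrow> 'a measure" where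
  "kernel_measure s \<kappa> =
     distr (density lborel (\<lambda>r. ennreal (indicator {0<..} r * r powr (- 1 - 2 * s))) \<Otimes>\<^sub>M \<kappa>)
       borel (\<lambda>(r, \<theta>). r *\<^sub>R \<theta>)"

definition reflect_measure :: "'a::euclidean_space measure \<Rightarrow> 'a measure" where
  "reflect_measure \<kappa> = distr \<kappa> sphere_borel uminus"

definition admissible ::
    "real \<Rightarrow> real \<Rightarrow> real \<Rightarrow> 'a::euclidean_space measure \<Rightarrow> 'a \<Rightarrow> bool" where
  "admissible lam Lam s \<kappa> b \<longleftrightarrow>
     sets \<kappa> = sets sphere_borel \<and> finite_measure \<kappa> \<and>
     lam \<le> (INF \<nu>\<in>sphere 0 1. LINT \<theta>|\<kappa>. \<bar>\<nu> \<bullet> \<theta>\<bar> powr (2 * s)) \<and>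
     measure \<kappa> (sphere 0 1) \<le> Lam \<and>
     (s = 1/2 \<longrightarrow> (LINT \<theta>|\<kappa>. \<theta>) = 0 \<and> norm b \<le> Lam)"

(* frechet_derivative u (at x) y is (grad u)(x) . y.  The drift b only enters for s = 1/2. *)
definition nonlocal_op ::
    "real \<Rightarrow> 'a::euclidean_space measure \<Rightarrow> 'a \<Rightarrow> ('a \<Rightarrow> real) \<Rightarrow> 'a \<Rightarrow> real" where
  "nonlocal_op s \<kappa> b u x =
     (if s < 1/2 then
        (LINT y|kernel_measure s \<kappa>. u x - u (x + y))
      else if s = 1/2 then
        Lim (at_right 0)
          (\<lambda>\<epsilon>. LINT y:{y. \<epsilon> < norm y}|kernel_measure s \<kappa>. u x - u (x + y))
        + frechet_derivative u (at x) b
      else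
        (LINT y|kernel_measure s \<kappa>. u x - u (x + y) + frechet_derivative u (at x) y))"

definition adjoint_op ::
    "real \<Rightarrow> 'a::euclidean_space measure \<Rightarrow> 'a \<Rightarrow> ('a \<Rightarrow> real) \<Rightarrow> 'a \<Rightarrow> real" where
  "adjoint_op s \<kappa> b = nonlocal_op s (reflect_measure \<kappa>) (- b)"

primrec k_times_diff :: "nat \<Rightarrow> ('a::euclidean_space \<Rightarrow> real) \<Rightarrow> bool" where
  "k_times_diff 0 f \<longleftrightarrow> continuous_on UNIV f"
| "k_times_diff (Suc k) f \<longleftrightarrow>
     (\<forall>x. f differentiable (at x)) \<and>
     (\<forall>v. k_times_diff k (\<lambda>x. frechet_derivative f (at x) v))"

definition test_function :: "'a::euclidean_space set \<Rightarrow> ('a \<Rightarrow> real) \<Rightarrow> bool" where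
  "test_function \<Omega> \<eta> \<longleftrightarrow>
     (\<forall>k. k_times_diff k \<eta>) \<and>
     compact (closure {x. \<eta> x \<noteq> 0}) \<and> closure {x. \<eta> x \<noteq> 0} \<subseteq> \<Omega>"

(* Integrability is demanded because the Bochner integral of a non-integrable function is 0 by
   convention.  For bounded measurable u the first condition holds automatically for admissible
   operators, as L* eta is then integrable. *)
definition weak_solution ::
    "real \<Rightarrow> 'a::euclidean_space measure \<Rightarrow> 'a \<Rightarrow> 'a set \<Rightarrow> ('a \<Rightarrow> real) \<Rightarrow> ('a \<Rightarrow> real) \<Rightarrow> bool" where
  "weak_solution s \<kappa> b \<Omega> f u \<longleftrightarrow>
     (\<forall>\<eta>. test_function \<Omega> \<eta> \<longrightarrow>
        integrable lebesgue (\<lambda>x. u x * adjoint_op s \<kappa> b \<eta> x) \<and>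
        set_integrable lebesgue \<Omega> (\<lambda>x. f x * \<eta> x) \<and>
        (LINT x|lebesgue. u x * adjoint_op s \<kappa> b \<eta> x) = (LINT x:\<Omega>|lebesgue. f x * \<eta> x))"

end

(* The equation is used only through the pairings of u with translated test functions.  Fubini turns
   it into Lg = 0 pointwise for every mollification g of u and for the differences
   g = mollified f x - mollified f (x + a).  At a maximum of g the gradient vanishes, so Lg = 0 forces
   g to equal its maximum on the support of the kernel; quantitatively, if g (X n) tends to sup g, then
   so does g (X n + a) for a in the support.  Iterating, the differences along X n + k a telescope to a
   bounded quantity, hence sup g <= 0, and every point of the support is a period of the mollifications.
   The support is a cone which spans the space by the nondegeneracy condition, so u is constant. *)
theory Submission
  imports Defs
begin

section \<open>Smooth functions\<close>

text \<open>A bounded function on the whole space need not attain its supremum, and recentring at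
  almost maximal points would call for a compactness argument. Maximizing sequences with explicit
  Lipschitz and Taylor constants replace it: these constants do not depend on the base point,
  because Lebesgue measure is translation invariant. The kernel may be carried by finitely many
  rays, and for s \<noteq> 1/2 these may all point into one half-space; a maximum of the
  mollification itself then spreads only in forward directions and need not reach every point.
  Passing to the difference in one direction a makes a single ray sufficient, and the boundedness of
  the mollification takes over the role of the geometry. No regularity of u is required, since every
  derivative falls on the test function.\<close>

lemma frechet_derivative_eq:
  "(f has_derivative f') (at x) \<Longrightarrow> frechet_derivative f (at x) = f'"
  using frechet_derivative_at by metis

lemma k_times_diff_Suc_has_derivative:
  "k_times_diff (Suc k) f \<Longrightarrow> (f has_derivative frechet_derivative f (at x)) (at x)"
  by (simp add: frechet_derivative_works[symmetric])

lemma k_times_diff_continuous: "k_times_diff k f \<Longrightarrow> continuous_on UNIV f"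
  by (cases k) (auto intro!: continuous_at_imp_continuous_on differentiable_imp_continuous_within)

lemma k_times_diff_SucD: "k_times_diff (Suc k) f \<Longrightarrow> k_times_diff k f"
proof (induction k arbitrary: f)
  case 0
  then show ?case using k_times_diff_continuous[of "Suc 0" f] by simp
next
  case (Suc k)
  then show ?case by (metis k_times_diff.simps(2))
qed

lemma k_times_diff_const: "k_times_diff k (\<lambda>_. c)"
  by (induction k arbitrary: c) auto

lemma k_times_diff_add:
  "k_times_diff k f \<Longrightarrow> k_times_diff k g \<Longrightarrow> k_times_diff k (\<lambda>x. f x + g x)"
proof (induction k arbitrary: f g)
  case 0
  then show ?case by (simp add: continuous_on_add)
next
  case (Suc k)
  have D: "((\<lambda>x. f x + g x) has_derivative
      (\<lambda>v. frechet_derivative f (at x) v + frechet_derivative g (at x) v)) (at x)" for x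
    by (intro has_derivative_add k_times_diff_Suc_has_derivative[OF Suc.prems(1)]
        k_times_diff_Suc_has_derivative[OF Suc.prems(2)])
  show ?case
    using Suc D by (auto simp: frechet_derivative_eq[OF D] differentiable_def)
qed

lemma k_times_diff_mult:
  "k_times_diff k f \<Longrightarrow> k_times_diff k g \<Longrightarrow> k_times_diff k (\<lambda>x. f x * g x)"
proof (induction k arbitrary: f g)
  case 0
  then show ?case by (simp add: continuous_on_mult)
next
  case (Suc k)
  have D: "((\<lambda>x. f x * g x) has_derivative
      (\<lambda>v. f x * frechet_derivative g (at x) v + frechet_derivative f (at x) v * g x)) (at x)" for x
    by (intro has_derivative_mult k_times_diff_Suc_has_derivative[OF Suc.prems(1)]
        k_times_diff_Suc_has_derivative[OF Suc.prems(2)])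
  have "k_times_diff k f" "k_times_diff k g"
    using Suc.prems k_times_diff_SucD by auto
  then show ?case
    using Suc D
    by (auto simp: frechet_derivative_eq[OF D] differentiable_def intro!: k_times_diff_add Suc.IH)
qed

lemma k_times_diff_prod:
  assumes "finite I" "\<And>i. i \<in> I \<Longrightarrow> k_times_diff k (f i)"
  shows "k_times_diff k (\<lambda>x. \<Prod>i\<in>I. f i x)"
  using assms by (induction I rule: finite_induct) (auto intro: k_times_diff_mult k_times_diff_const)

lemma k_times_diff_inner: "k_times_diff k (\<lambda>x. x \<bullet> c)"
proof (cases k)
  case 0
  then show ?thesis by (simp add: continuous_on_inner)
next
  case (Suc m)
  have D: "((\<lambda>x. x \<bullet> c) has_derivative (\<lambda>v. v \<bullet> c)) (at x)" for x :: 'a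
    by (auto intro!: derivative_eq_intros)
  show ?thesis unfolding Suc
    using D by (auto simp: frechet_derivative_eq[OF D] differentiable_def intro: k_times_diff_const)
qed

lemma has_derivative_translate:
  fixes f :: "'a::euclidean_space \<Rightarrow> real"
  assumes "(f has_derivative f') (at (x - a))"
  shows "((\<lambda>x. f (x - a)) has_derivative f') (at x)"
proof -
  have "((\<lambda>x. x - a) has_derivative (\<lambda>v. v)) (at x)"
    by (auto intro!: derivative_eq_intros)
  from has_derivative_compose[OF this, of f f'] show ?thesis
    using assms by simp
qed

lemma k_times_diff_translate:
  "k_times_diff k f \<Longrightarrow> k_times_diff k (\<lambda>x. f (x - a))"
proof (induction k arbitrary: f)
  case 0
  then show ?case
    by (auto intro!: continuous_on_compose2[of UNIV f] continuous_on_diff)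
next
  case (Suc k)
  have D: "((\<lambda>x. f (x - a)) has_derivative frechet_derivative f (at (x - a))) (at x)" for x
    by (intro has_derivative_translate k_times_diff_Suc_has_derivative[OF Suc.prems])
  show ?case
    using Suc D by (auto simp: frechet_derivative_eq[OF D] differentiable_def)
qed

section \<open>Translates, differences and derivatives of test functions\<close>

definition translate :: "'a::euclidean_space \<Rightarrow> ('a \<Rightarrow> real) \<Rightarrow> 'a \<Rightarrow> real" where
  "translate a f x = f (x - a)"

lemma translate_0 [simp]: "translate 0 f = f"
  by (simp add: translate_def fun_eq_iff)

lemma translate_translate [simp]: "translate a (translate b f) = translate (a + b) f"
  by (simp add: translate_def fun_eq_iff algebra_simps)

lemma test_function_UNIV_iff:
  "test_function UNIV f \<longleftrightarrow> (\<forall>k. k_times_diff k f) \<and> bounded {x. f x \<noteq> 0}"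
  by (auto simp: test_function_def compact_closure)

lemma test_function_translate:
  assumes "test_function UNIV f"
  shows "test_function UNIV (translate a f)"
proof -
  have "{x. f (x - a) \<noteq> 0} = (+) a ` {x. f x \<noteq> 0}"
    by (auto simp: image_iff intro!: exI[of _ "_ - a"])
  then show ?thesis
    using assms
    by (simp add: test_function_UNIV_iff translate_def[abs_def] k_times_diff_translate bounded_translation)
qed

lemma test_function_uminus:
  assumes "test_function UNIV f"
  shows "test_function UNIV (\<lambda>x. - f x)"
  using assms k_times_diff_mult[OF k_times_diff_const[of _ "-1"], of _ f]
  by (simp add: test_function_UNIV_iff)

lemma test_function_diff:
  assumes "test_function UNIV f" "test_function UNIV g"
  shows "test_function UNIV (\<lambda>x. f x - g x)"
proof -
  have "bounded ({x. f x \<noteq> 0} \<union> {x. g x \<noteq> 0})"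
    using assms by (simp add: test_function_UNIV_iff)
  then have "bounded {x. f x - g x \<noteq> 0}"
    by (rule bounded_subset) auto
  then show ?thesis
    using assms test_function_uminus[OF assms(2)] k_times_diff_add[of _ f "\<lambda>x. - g x"]
    by (simp add: test_function_UNIV_iff)
qed

lemma test_function_has_derivative:
  "test_function UNIV f \<Longrightarrow> (f has_derivative frechet_derivative f (at x)) (at x)"
  unfolding test_function_def by (meson k_times_diff_Suc_has_derivative)

lemma test_function_frechet_derivative_translate:
  assumes "test_function UNIV f"
  shows "frechet_derivative (translate a f) (at x) = frechet_derivative f (at (x - a))"
  unfolding translate_def
  by (intro frechet_derivative_eq has_derivative_translate test_function_has_derivative assms)

text \<open>Off the closed support f vanishes in a whole neighbourhood, hence so does its
  derivative. This closure property lets first-order bounds be applied to the partial derivatives,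
  which yields the second-order ones.\<close>

lemma test_function_frechet_derivative:
  assumes "test_function UNIV f"
  shows "test_function UNIV (\<lambda>x. frechet_derivative f (at x) v)"
proof -
  have "frechet_derivative f (at x) v = 0" if x: "x \<notin> closure {x. f x \<noteq> 0}" for x
  proof -
    have "(f has_derivative (\<lambda>_. 0)) (at x)"
      by (rule has_derivative_transform_within_open[of "\<lambda>_. 0" _ _ _ "- closure {x. f x \<noteq> 0}"])
        (use x closure_subset[of "{x. f x \<noteq> 0}"] in auto)
    then show ?thesis
      by (simp add: frechet_derivative_eq)
  qed
  then have "bounded {x. frechet_derivative f (at x) v \<noteq> 0}"
    using assms unfolding test_function_def
    by (metis (mono_tags, lifting) bounded_subset compact_imp_bounded mem_Collect_eq subsetI)
  then show ?thesis
    using assms unfolding test_function_UNIV_iff by (metis k_times_diff.simps(2))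
qed

section \<open>Smooth approximations of the indicator of a box\<close>

definition flat :: "nat \<Rightarrow> real \<Rightarrow> real" where
  "flat j t = (if t > 0 then exp (- 1 / t) / t ^ j else 0)"

lemma flat_tendsto_0: "((\<lambda>t. exp (- 1 / t) / t ^ j) \<longlongrightarrow> (0::real)) (at_right 0)"
proof -
  have "((\<lambda>t. inverse t ^ j / exp (inverse t)) \<longlongrightarrow> (0::real)) (at_right 0)"
    by (rule filterlim_compose[OF tendsto_power_div_exp_0 filterlim_inverse_at_top_right])
  then show ?thesis
    by (simp add: exp_minus field_simps)
qed

text \<open>The derivative is again a linear combination of members of the family; this is the
  purpose of the index j. One induction on the order of differentiation, for all j at once, then
  gives smoothness of \<open>flat j\<close> composed with a smooth function.\<close>

lemma has_real_derivative_flat: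
  "(flat j has_real_derivative (flat (j + 2) t - real j * flat (j + 1) t)) (at t)"
proof -
  consider "t > 0" | "t < 0" | "t = 0" by linarith
  then show ?thesis
  proof cases
    case 1
    have P: "((\<lambda>t. t ^ j) has_real_derivative real j * t ^ j / t) (at t)"
      using 1 DERIV_pow[of j t UNIV] by (cases j) auto
    have E: "((\<lambda>t. exp (- 1 / t)) has_real_derivative exp (- 1 / t) / t\<^sup>2) (at t)"
      using 1 by (auto intro!: derivative_eq_intros simp: field_simps power2_eq_square)
    have "((\<lambda>t. exp (- 1 / t) / t ^ j) has_real_derivative (flat (j + 2) t - real j * flat (j + 1) t)) (at t)"
      by (rule DERIV_cong[OF DERIV_divide[OF E P]])
        (use 1 in \<open>auto simp: flat_def field_simps power2_eq_square\<close>)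
    then show ?thesis
      by (rule has_field_derivative_transform_within_open[of _ _ _ "{0<..}"]) (use 1 in \<open>auto simp: flat_def\<close>)
  next
    case 2
    have "((\<lambda>t. 0) has_real_derivative (flat (j + 2) t - real j * flat (j + 1) t)) (at t)"
      using 2 by (auto simp: flat_def)
    then show ?thesis
      by (rule has_field_derivative_transform_within_open[of _ _ _ "{..<0}"]) (use 2 in \<open>auto simp: flat_def\<close>)
  next
    case 3
    \<comment> \<open>At the gluing point 0 the right difference quotient of \<open>flat j\<close>
      is \<open>flat (j + 1)\<close>, which tends to 0; the left one is identically 0.\<close>
    have "((\<lambda>h. flat j h / h) \<longlongrightarrow> 0) (at_right 0)"
      by (rule Lim_transform_eventually[OF flat_tendsto_0[of "j + 1"]])
        (auto simp: eventually_at_filter flat_def field_simps)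
    moreover have "((\<lambda>h. flat j h / h) \<longlongrightarrow> 0) (at_left 0)"
      by (rule Lim_transform_eventually[OF tendsto_const])
        (auto simp: eventually_at_filter flat_def)
    ultimately have "((\<lambda>h. flat j h / h) \<longlongrightarrow> 0) (at 0)"
      using filterlim_split_at by blast
    then show ?thesis
      unfolding 3 DERIV_def by (simp add: flat_def)
  qed
qed

lemma k_times_diff_flat:
  assumes "\<And>k. k_times_diff k q"
  shows "k_times_diff k (\<lambda>x. flat j (q x))"
proof (induction k arbitrary: j)
  case 0
  have "continuous_on UNIV (flat j)"
    by (meson DERIV_isCont continuous_at_imp_continuous_on has_real_derivative_flat)
  then show ?case
    using continuous_on_compose2[of UNIV "flat j" UNIV q] assms[of 0] by auto
next
  case (Suc k)
  let ?d = "\<lambda>t. flat (j + 2) t - real j * flat (j + 1) t"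
  have D: "((\<lambda>x. flat j (q x)) has_derivative (\<lambda>v. ?d (q x) * frechet_derivative q (at x) v)) (at x)" for x
    using has_derivative_compose[OF k_times_diff_Suc_has_derivative[OF assms[of "Suc k"], of x],
        of "flat j" "(*) (?d (q x))"] has_real_derivative_flat[of j "q x"]
    by (simp add: has_field_derivative_def)
  have "k_times_diff k (\<lambda>x. ?d (q x))"
    using k_times_diff_add[OF Suc[of "j + 2"] k_times_diff_mult[OF k_times_diff_const[of _ "- real j"] Suc[of "j + 1"]]]
    by simp
  then have "k_times_diff k (\<lambda>x. ?d (q x) * frechet_derivative q (at x) v)" for v
    using assms[of "Suc k"] by (intro k_times_diff_mult) auto
  then show ?case
    using D by (auto simp: frechet_derivative_eq[OF D] differentiable_def)
qed

text \<open>For ordered corners each quadratic is positive exactly between them, and where its value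
  is e > 0 the factor exp (-1 / ((n + 1) e)) tends to 1. The scaling by n + 1 thus turns one bump
  into a sequence converging to the indicator of the open box.\<close>

definition box_bump :: "'a::euclidean_space \<Rightarrow> 'a \<Rightarrow> nat \<Rightarrow> 'a \<Rightarrow> real" where
  "box_bump l r n x =
     (\<Prod>i\<in>Basis. flat 0 (real (Suc n) * ((x \<bullet> i - l \<bullet> i) * (r \<bullet> i - x \<bullet> i))))"

text \<open>Ordered corners exclude that both factors of a quadratic are negative, so outside the
  box some quadratic is nonpositive and \<open>flat 0\<close> vanishes there.\<close>

lemma box_bump_outside:
  assumes "\<And>i. i \<in> Basis \<Longrightarrow> l \<bullet> i \<le> r \<bullet> i" "x \<notin> box l r"
  shows "box_bump l r n x = 0"
proof -
  obtain i where i: "i \<in> Basis" "\<not> (l \<bullet> i < x \<bullet> i \<and> x \<bullet> i < r \<bullet> i)"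
    using assms(2) by (auto simp: mem_box)
  then have "(x \<bullet> i - l \<bullet> i) * (r \<bullet> i - x \<bullet> i) \<le> 0"
    using assms(1)[of i] by (auto simp: mult_le_0_iff)
  then have "flat 0 (real (Suc n) * ((x \<bullet> i - l \<bullet> i) * (r \<bullet> i - x \<bullet> i))) = 0"
    unfolding flat_def by (metis less_le_not_le mult_nonneg_nonpos of_nat_0_le_iff)
  then show ?thesis
    using i unfolding box_bump_def by auto
qed

lemma test_function_box_bump:
  assumes "\<And>i. i \<in> Basis \<Longrightarrow> l \<bullet> i \<le> r \<bullet> i"
  shows "test_function UNIV (box_bump l r n)"
proof -
  have q: "k_times_diff k (\<lambda>x. real (Suc n) * ((x \<bullet> i - l \<bullet> i) * (r \<bullet> i - x \<bullet> i)))" for k and i :: 'a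
  proof -
    have "k_times_diff k (\<lambda>x. x \<bullet> i - l \<bullet> i)"
      using k_times_diff_add[OF k_times_diff_inner k_times_diff_const, of k i "- (l \<bullet> i)"] by simp
    moreover have "k_times_diff k (\<lambda>x. r \<bullet> i - x \<bullet> i)"
      using k_times_diff_add[OF k_times_diff_const k_times_diff_inner, of k "r \<bullet> i" "- i"] by simp
    ultimately show ?thesis
      by (intro k_times_diff_mult k_times_diff_const)
  qed
  have "k_times_diff k (box_bump l r n)" for k
    unfolding box_bump_def
    by (intro k_times_diff_prod k_times_diff_flat q finite_Basis)
  moreover have "bounded {x. box_bump l r n x \<noteq> 0}"
    by (rule bounded_subset[OF bounded_box[of l r]]) (use box_bump_outside[OF assms] in auto)
  ultimately show ?thesis
    by (simp add: test_function_UNIV_iff)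
qed

lemma abs_box_bump_le:
  assumes "\<And>i. i \<in> Basis \<Longrightarrow> l \<bullet> i \<le> r \<bullet> i"
  shows "\<bar>box_bump l r n x\<bar> \<le> indicator (box l r) x"
proof (cases "x \<in> box l r")
  case True
  have "\<bar>box_bump l r n x\<bar> \<le> 1"
    unfolding box_bump_def abs_prod by (intro prod_le_1) (auto simp: flat_def)
  then show ?thesis using True by simp
qed (use box_bump_outside[OF assms] in auto)

lemma box_bump_tendsto:
  assumes "\<And>i. i \<in> Basis \<Longrightarrow> l \<bullet> i \<le> r \<bullet> i"
  shows "(\<lambda>n. box_bump l r n x) \<longlonglongrightarrow> indicator (box l r) x"
proof (cases "x \<in> box l r")
  case True
  have "(\<lambda>n. flat 0 (real (Suc n) * ((x \<bullet> i - l \<bullet> i) * (r \<bullet> i - x \<bullet> i)))) \<longlonglongrightarrow> 1" if "i \<in> Basis" for i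
  proof -
    define e where "e = (x \<bullet> i - l \<bullet> i) * (r \<bullet> i - x \<bullet> i)"
    have e: "e > 0" using True that by (simp add: e_def mem_box)
    have "(\<lambda>n. exp (- 1 / e * (1 / real (Suc n)))) \<longlonglongrightarrow> exp (- 1 / e * 0)"
      by (intro tendsto_intros LIMSEQ_Suc[OF lim_1_over_n])
    moreover have "flat 0 (real (Suc n) * e) = exp (- 1 / e * (1 / real (Suc n)))" for n
    proof -
      have "real (Suc n) * e > 0" using e by simp
      then show ?thesis by (simp add: flat_def mult.commute)
    qed
    ultimately show ?thesis
      unfolding e_def by simp
  qed
  then have "(\<lambda>n. box_bump l r n x) \<longlonglongrightarrow> (\<Prod>i\<in>(Basis::'a set). 1)"
    unfolding box_bump_def by (intro tendsto_prod)
  then show ?thesis using True by simp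
qed (use box_bump_outside[OF assms] in auto)

section \<open>Increments of test functions\<close>

lemma test_function_continuous: "test_function UNIV f \<Longrightarrow> continuous_on UNIV f"
  unfolding test_function_def by (meson k_times_diff_continuous)

lemma test_function_borel [measurable_dest]: "test_function UNIV f \<Longrightarrow> f \<in> borel_measurable borel"
  by (intro borel_measurable_continuous_onI test_function_continuous)

lemma test_function_linear: "test_function UNIV f \<Longrightarrow> linear (frechet_derivative f (at x))"
  by (rule has_derivative_linear[OF test_function_has_derivative])

text \<open>Reduces the derivative in an arbitrary direction to finitely many partial derivatives,
  each a test function; uniform bounds and joint measurability rest on this.\<close>

lemma frechet_derivative_eq_sum:
  assumes "test_function UNIV f"
  shows "frechet_derivative f (at x) v = (\<Sum>i\<in>Basis. (v \<bullet> i) * frechet_derivative f (at x) i)"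
proof -
  have "frechet_derivative f (at x) v = frechet_derivative f (at x) (\<Sum>i\<in>Basis. (v \<bullet> i) *\<^sub>R i)"
    by (simp add: euclidean_representation)
  also have "\<dots> = (\<Sum>i\<in>Basis. (v \<bullet> i) * frechet_derivative f (at x) i)"
    using test_function_linear[OF assms, of x] by (simp add: linear_sum linear_cmul)
  finally show ?thesis .
qed

section \<open>Uniform first- and second-order bounds\<close>

lemma test_function_bounded:
  assumes "test_function UNIV f"
  obtains C where "0 \<le> C" "\<And>x. \<bar>f x\<bar> \<le> C"
proof -
  have "compact (f ` closure {x. f x \<noteq> 0})"
    using assms test_function_continuous[OF assms]
    by (intro compact_continuous_image) (auto simp: test_function_def intro: continuous_on_subset)
  then obtain C where C: "\<And>x. x \<in> closure {x. f x \<noteq> 0} \<Longrightarrow> \<bar>f x\<bar> \<le> C"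
    using compact_imp_bounded bounded_iff by (metis image_eqI real_norm_def)
  have "\<bar>f x\<bar> \<le> max C 0" for x
    using C[of x] closure_subset[of "{x. f x \<noteq> 0}"] by (cases "f x = 0") auto
  then show thesis by (intro that[of "max C 0"]) auto
qed

lemma test_function_derivative_bounded:
  assumes "test_function UNIV f"
  obtains C where "0 \<le> C" "\<And>x v. \<bar>frechet_derivative f (at x) v\<bar> \<le> C * norm v"
proof -
  have "\<exists>C\<ge>0. \<forall>x. \<bar>frechet_derivative f (at x) i\<bar> \<le> C" for i
    using test_function_bounded[OF test_function_frechet_derivative[OF assms, of i]] by metis
  then obtain C where C: "\<And>i. C i \<ge> 0" "\<And>i x. \<bar>frechet_derivative f (at x) i\<bar> \<le> C i" by metis
  have "\<bar>frechet_derivative f (at x) v\<bar> \<le> (\<Sum>i\<in>Basis. C i) * norm v" for x v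
  proof -
    have "\<bar>frechet_derivative f (at x) v\<bar> \<le> (\<Sum>i\<in>Basis. \<bar>(v \<bullet> i) * frechet_derivative f (at x) i\<bar>)"
      by (subst frechet_derivative_eq_sum[OF assms]) (rule sum_abs)
    also have "\<dots> \<le> (\<Sum>i\<in>Basis. norm v * C i)"
      unfolding abs_mult by (intro sum_mono mult_mono C Basis_le_norm) auto
    finally show ?thesis by (simp add: sum_distrib_left mult.commute)
  qed
  then show thesis using C(1) by (intro that[of "\<Sum>i\<in>Basis. C i"]) (auto intro: sum_nonneg)
qed

lemma test_function_lipschitz:
  assumes "test_function UNIV f"
  obtains C where "0 \<le> C" "\<And>x y. \<bar>f x - f y\<bar> \<le> C * norm (x - y)"
proof -
  obtain C where C: "0 \<le> C" "\<And>x v. \<bar>frechet_derivative f (at x) v\<bar> \<le> C * norm v"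
    using test_function_derivative_bounded[OF assms] by blast
  have "norm (f x - f y) \<le> C * norm (x - y)" for x y
    by (rule differentiable_bound[of UNIV _ "\<lambda>x. frechet_derivative f (at x)"])
      (auto intro!: test_function_has_derivative[OF assms] onorm_bound C)
  then show thesis using C(1) that by auto
qed

lemma test_function_derivative_lipschitz:
  assumes "test_function UNIV f"
  obtains C where "0 \<le> C"
    "\<And>x y v. \<bar>frechet_derivative f (at x) v - frechet_derivative f (at y) v\<bar> \<le> C * norm (x - y) * norm v"
proof -
  have "\<exists>C\<ge>0. \<forall>x y. \<bar>frechet_derivative f (at x) i - frechet_derivative f (at y) i\<bar> \<le> C * norm (x - y)" for i
    using test_function_lipschitz[OF test_function_frechet_derivative[OF assms, of i]] by metis
  then obtain C where C: "\<And>i. C i \<ge> 0"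
    "\<And>i x y. \<bar>frechet_derivative f (at x) i - frechet_derivative f (at y) i\<bar> \<le> C i * norm (x - y)" by metis
  have "\<bar>frechet_derivative f (at x) v - frechet_derivative f (at y) v\<bar> \<le> (\<Sum>i\<in>Basis. C i) * norm (x - y) * norm v" for x y v
  proof -
    have "frechet_derivative f (at x) v - frechet_derivative f (at y) v
       = (\<Sum>i\<in>Basis. (v \<bullet> i) * (frechet_derivative f (at x) i - frechet_derivative f (at y) i))"
      by (simp add: frechet_derivative_eq_sum[OF assms, of _ v] right_diff_distrib sum_subtractf)
    also have "\<bar>\<dots>\<bar> \<le> (\<Sum>i\<in>Basis. \<bar>(v \<bullet> i) * (frechet_derivative f (at x) i - frechet_derivative f (at y) i)\<bar>)"
      by (rule sum_abs)
    also have "\<dots> \<le> (\<Sum>i\<in>Basis. norm v * (C i * norm (x - y)))"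
      unfolding abs_mult by (intro sum_mono mult_mono C Basis_le_norm) auto
    finally show ?thesis by (simp add: sum_distrib_left sum_distrib_right mult_ac)
  qed
  then show thesis using C(1) by (intro that[of "\<Sum>i\<in>Basis. C i"]) (auto intro: sum_nonneg)
qed

text \<open>The mean value inequality is applied to f minus its linearization at w, on the ball of
  radius |y|, where the derivative varies by at most C |y|. What matters is that the constant is
  uniform in w.\<close>

lemma test_function_taylor:
  assumes "test_function UNIV f"
  obtains C where "0 \<le> C" "\<And>w y. \<bar>f w - f (w - y) - frechet_derivative f (at w) y\<bar> \<le> C * (norm y)\<^sup>2"
proof -
  obtain C where C: "0 \<le> C"
    "\<And>x y v. \<bar>frechet_derivative f (at x) v - frechet_derivative f (at y) v\<bar> \<le> C * norm (x - y) * norm v"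
    using test_function_derivative_lipschitz[OF assms] by blast
  have "\<bar>f w - f (w - y) - frechet_derivative f (at w) y\<bar> \<le> C * (norm y)\<^sup>2" for w y
  proof -
    have "norm (f (w - y) - f w - frechet_derivative f (at w) ((w - y) - w)) \<le> norm ((w - y) - w) * (C * norm y)"
    proof (rule differentiable_bound_linearization[where S = "cball w (norm y)"])
      fix t :: real assume "t \<in> {0..1}"
      then show "w + t *\<^sub>R (w - y - w) \<in> cball w (norm y)"
        by (auto simp: dist_norm intro: mult_left_le_one_le)
    next
      fix x assume "x \<in> cball w (norm y)"
      then have "norm (x - w) \<le> norm y" by (simp add: dist_norm norm_minus_commute)
      then have "C * norm (x - w) * norm v \<le> C * norm y * norm v" for v :: 'a
        using C(1) by (intro mult_right_mono mult_left_mono) auto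
      then show "onorm (frechet_derivative f (at x) - frechet_derivative f (at w)) \<le> C * norm y"
        unfolding fun_diff_def using C(2)[of x _ w] by (intro onorm_le) (metis order_trans real_norm_def)
    qed (auto intro: has_derivative_at_withinI test_function_has_derivative[OF assms])
    moreover have "frechet_derivative f (at w) (- y) = - frechet_derivative f (at w) y"
      by (rule linear_neg[OF test_function_linear[OF assms]])
    ultimately show ?thesis
      by (simp add: power2_eq_square mult_ac abs_minus_commute)
  qed
  then show thesis using C(1) that by blast
qed

text \<open>The exponents \<open>p\<close> (near \<open>0\<close>) and \<open>q\<close> (near \<open>\<infinity>\<close>) treat the three ranges of \<open>s\<close> at once:
  \<open>(1, 0)\<close>, \<open>(2, 0)\<close> and \<open>(2, 1)\<close> for \<open>s < 1/2\<close>, \<open>s = 1/2\<close> and \<open>s > 1/2\<close>.  The gradient term is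
  subtracted where the kernel requires it (where it cancels, if \<open>s = 1/2\<close>).\<close>

definition weight :: "nat \<Rightarrow> nat \<Rightarrow> 'a::euclidean_space \<Rightarrow> real" where
  "weight p q y = (if norm y \<le> 1 then norm y ^ p else norm y ^ q)"

definition grad_cutoff :: "nat \<Rightarrow> nat \<Rightarrow> 'a::euclidean_space \<Rightarrow> real" where
  "grad_cutoff p q y = (if norm y \<le> 1 then of_bool (p = 2) else of_bool (q = 1))"

text \<open>Up to the drift this is the integrand of the adjoint after replacing y by -y, hence the
  argument w - y: the reflection moves from the kernel to the increment, and all later integrals run
  against the kernel of \<open>\<kappa>\<close> itself.\<close>

definition increment :: "nat \<Rightarrow> nat \<Rightarrow> ('a::euclidean_space \<Rightarrow> real) \<Rightarrow> 'a \<Rightarrow> 'a \<Rightarrow> real" where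
  "increment p q f y w = f w - f (w - y) - grad_cutoff p q y * frechet_derivative f (at w) y"

lemma weight_nonneg: "0 \<le> weight p q y"
  by (simp add: weight_def)

lemma borel_measurable_weight [measurable]: "weight p q \<in> borel_measurable borel"
  unfolding weight_def by measurable

lemma borel_measurable_grad_cutoff [measurable]: "grad_cutoff p q \<in> borel_measurable borel"
  unfolding grad_cutoff_def by measurable

lemma borel_measurable_frechet_derivative_pair:
  assumes "test_function UNIV f"
  shows "(\<lambda>(y, w). frechet_derivative f (at w) y) \<in> borel_measurable (borel \<Otimes>\<^sub>M borel)"
proof -
  have [measurable]: "(\<lambda>w. frechet_derivative f (at w) i) \<in> borel_measurable borel" for i
    by (intro test_function_borel test_function_frechet_derivative assms)
  show ?thesis
    by (subst frechet_derivative_eq_sum[OF assms]) measurable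
qed

lemma borel_measurable_increment_pair:
  assumes "test_function UNIV f"
  shows "(\<lambda>(y, w). increment p q f y w) \<in> borel_measurable (borel \<Otimes>\<^sub>M borel)"
proof -
  note [measurable] = test_function_borel[OF assms]
  have [measurable]: "(\<lambda>x. frechet_derivative f (at (snd x)) (fst x)) \<in> borel_measurable (borel \<Otimes>\<^sub>M borel)"
    using borel_measurable_frechet_derivative_pair[OF assms] by (simp add: case_prod_beta)
  show ?thesis unfolding increment_def case_prod_beta by measurable
qed

text \<open>Near 0 the Lipschitz bound (p = 1) or the Taylor bound (p = 2) applies, far away the sup
  bounds of f and of its derivative. The two indicators record that the increment vanishes unless w
  or w - y is close to the support; they make the bound integrable in w with an integral that
  depends on y only through the weight.\<close>

lemma increment_bound:
  assumes f: "test_function UNIV f" and p: "p = 1 \<or> p = 2" and q: "q = 0 \<or> q = 1"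
  obtains C R where "0 \<le> C"
    "\<And>y w. \<bar>increment p q f y w\<bar>
      \<le> C * weight p q y * (indicator (cball 0 R) w + indicator (cball 0 R) (w - y))"
proof -
  obtain A where A: "0 \<le> A" "\<And>x. \<bar>f x\<bar> \<le> A"
    using test_function_bounded[OF f] by blast
  obtain B where B: "0 \<le> B" "\<And>x v. \<bar>frechet_derivative f (at x) v\<bar> \<le> B * norm v"
    using test_function_derivative_bounded[OF f] by blast
  obtain L where L: "0 \<le> L" "\<And>x y. \<bar>f x - f y\<bar> \<le> L * norm (x - y)"
    using test_function_lipschitz[OF f] by blast
  obtain T where T: "0 \<le> T" "\<And>w y. \<bar>f w - f (w - y) - frechet_derivative f (at w) y\<bar> \<le> T * (norm y)\<^sup>2"
    using test_function_taylor[OF f] by blast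
  obtain R where R: "\<And>x. f x \<noteq> 0 \<Longrightarrow> norm x \<le> R"
    using f unfolding test_function_UNIV_iff bounded_iff by blast
  have f0: "f x = 0" if "norm x > R" for x using R that by force
  have d0: "frechet_derivative f (at x) v = 0" if "norm x > R" for x v
  proof -
    have "open {x. norm x > R}" by (intro open_Collect_less continuous_intros)
    then have "(f has_derivative (\<lambda>_. 0)) (at x)"
      by (rule has_derivative_transform_within_open[OF has_derivative_const[of 0]])
        (use f0 that in simp_all)
    then show ?thesis by (simp add: frechet_derivative_eq)
  qed
  define C where "C = A + B + L + T"
  have "\<bar>increment p q f y w\<bar>
      \<le> C * weight p q y * (indicator (cball 0 (R + 1)) w + indicator (cball 0 (R + 1)) (w - y))" for y w
  proof (cases "norm w > R + 1 \<and> norm (w - y) > R + 1")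
    case True
    then show ?thesis
      using A(1) B(1) L(1) T(1) by (simp add: increment_def f0 d0)
  next
    case False
    have "\<bar>increment p q f y w\<bar> \<le> C * weight p q y" if le: "norm y \<le> 1"
      using p
    proof
      assume "p = 1"
      then have "\<bar>increment p q f y w\<bar> \<le> L * norm y"
        using L(2)[of w "w - y"] le by (simp add: increment_def grad_cutoff_def)
      also have "\<dots> \<le> C * norm y"
        using A B T by (intro mult_right_mono) (auto simp: C_def)
      finally show ?thesis using le \<open>p = 1\<close> by (simp add: weight_def)
    next
      assume "p = 2"
      then have "\<bar>increment p q f y w\<bar> \<le> T * (norm y)\<^sup>2"
        using T(2)[of w "y"] le by (simp add: increment_def grad_cutoff_def)
      also have "\<dots> \<le> C * (norm y)\<^sup>2"
        using A B L by (intro mult_right_mono) (auto simp: C_def)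
      finally show ?thesis using le \<open>p = 2\<close> by (simp add: weight_def)
    qed
    moreover have "\<bar>increment p q f y w\<bar> \<le> C * weight p q y *
       (indicator (cball 0 (R + 1)) w + indicator (cball 0 (R + 1)) (w - y))" if gt: "norm y > 1"
    proof -
      have fA: "\<bar>f x\<bar> \<le> A * indicator (cball 0 (R + 1)) x" for x
        using A f0[of x] by (auto simp: indicator_def)
      have dB: "\<bar>frechet_derivative f (at w) y\<bar> \<le> B * norm y * indicator (cball 0 (R + 1)) w"
        using B(2)[of w y] d0[of w y] by (auto simp: indicator_def)
      \<comment> \<open>Beyond the unit ball the gradient term is present only for q = 1, and there
        the weight is |y| itself, which absorbs the linear growth.\<close>
      have cut: "grad_cutoff p q y * norm y \<le> weight p q y" "1 \<le> weight p q y" "0 \<le> grad_cutoff p q y"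
        using gt q by (auto simp: grad_cutoff_def weight_def)
      have "\<bar>increment p q f y w\<bar> \<le> \<bar>f w\<bar> + \<bar>f (w - y)\<bar> + grad_cutoff p q y * \<bar>frechet_derivative f (at w) y\<bar>"
        unfolding increment_def using cut(3) by (simp add: abs_mult_pos' flip: abs_mult)
      also have "\<dots> \<le> A * indicator (cball 0 (R + 1)) w + A * indicator (cball 0 (R + 1)) (w - y)
          + grad_cutoff p q y * (B * norm y * indicator (cball 0 (R + 1)) w)"
        by (intro add_mono fA mult_left_mono dB cut)
      also have "grad_cutoff p q y * (B * norm y * indicator (cball 0 (R + 1)) w)
         \<le> B * weight p q y * indicator (cball 0 (R + 1)) w"
        using mult_left_mono[OF cut(1) B(1)] by (auto simp: indicator_def mult_ac)
      also have "A * indicator (cball 0 (R + 1)) w + A * indicator (cball 0 (R + 1)) (w - y)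
          + B * weight p q y * indicator (cball 0 (R + 1)) w \<le>
         A * weight p q y * indicator (cball 0 (R + 1)) w + A * weight p q y * indicator (cball 0 (R + 1)) (w - y)
          + B * weight p q y * indicator (cball 0 (R + 1)) w"
        using mult_left_mono[OF cut(2) A(1)] A(1) B(1) weight_nonneg[of p q y] by (intro add_mono mult_right_mono) auto
      also have "\<dots> \<le> C * weight p q y * indicator (cball 0 (R + 1)) w + C * weight p q y * indicator (cball 0 (R + 1)) (w - y)"
      proof -
        have "(A + B) * weight p q y * indicator (cball 0 (R + 1)) w \<le> C * weight p q y * indicator (cball 0 (R + 1)) w"
          "A * weight p q y * indicator (cball 0 (R + 1)) (w - y) \<le> C * weight p q y * indicator (cball 0 (R + 1)) (w - y)"
          using A(1) B(1) L(1) T(1) weight_nonneg[of p q y]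
          by (intro mult_right_mono; simp add: C_def)+
        then show ?thesis by (simp add: algebra_simps)
      qed
      finally show ?thesis by (simp add: distrib_left)
    qed
    moreover have "indicator (cball 0 (R + 1)) w + indicator (cball 0 (R + 1)) (w - y) \<ge> (1::real)"
      using False by (auto simp: indicator_def)
    then have "C * weight p q y \<le> C * weight p q y * (indicator (cball 0 (R + 1)) w + indicator (cball 0 (R + 1)) (w - y))"
      using mult_left_mono[of 1 _ "C * weight p q y"] A(1) B(1) L(1) T(1) weight_nonneg[of p q y]
      by (simp add: C_def)
    ultimately show ?thesis by (cases "norm y \<le> 1") (force intro: order_trans)+
  qed
  moreover have "0 \<le> C" using A B L T by (simp add: C_def)
  ultimately show thesis using that by blast
qed

section \<open>The kernel in polar coordinates\<close>

definition radial_measure :: "real \<Rightarrow> real measure" where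
  "radial_measure s = density lborel (\<lambda>r. ennreal (indicator {0<..} r * r powr (- 1 - 2 * s)))"

lemma sets_radial_measure [measurable_cong, simp]: "sets (radial_measure s) = sets borel"
  by (simp add: radial_measure_def)

lemma space_radial_measure [simp]: "space (radial_measure s) = UNIV"
  by (simp add: radial_measure_def)

lemma sigma_finite_radial_measure: "sigma_finite_measure (radial_measure s)"
  unfolding radial_measure_def
  by (subst sigma_finite_measure.sigma_finite_iff_density_finite[OF lborel.sigma_finite_measure_axioms]) auto

lemma space_sphere_borel [simp]: "space (sphere_borel :: 'a::euclidean_space measure) = sphere 0 1"
  by (simp add: sphere_borel_def space_restrict_space)

lemma measurable_sphere_borel: "(\<lambda>x. x) \<in> sphere_borel \<rightarrow>\<^sub>M borel"
  unfolding sphere_borel_def by (rule measurable_restrict_space1) simp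

lemma ball_Int_sphere_sets: "ball \<theta> r \<inter> sphere 0 1 \<in> sets sphere_borel"
  unfolding sphere_borel_def by (subst sets_restrict_space) auto

lemma sets_kernel_measure [measurable_cong, simp]: "sets (kernel_measure s \<kappa>) = sets borel"
  by (simp add: kernel_measure_def)

lemma space_kernel_measure [simp]: "space (kernel_measure s \<kappa>) = UNIV"
  by (simp add: kernel_measure_def)

lemma measurable_kernel_measure [simp]: "measurable (kernel_measure s \<kappa>) N = measurable borel N"
  by (rule measurable_cong_sets) auto

text \<open>Collects what the polar representation of the kernel requires, so that the same facts
  are available for the reflected measure.\<close>

locale spherical_kernel =
  fixes s :: real and \<kappa> :: "'a::euclidean_space measure"
  assumes sets_kappa [measurable_cong]: "sets \<kappa> = sets sphere_borel"
    and finite_kappa: "finite_measure \<kappa>"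
    and s_pos: "0 < s"
begin

sublocale finite_measure \<kappa> by (rule finite_kappa)

sublocale polar: pair_sigma_finite "radial_measure s" \<kappa>
  by (intro pair_sigma_finite.intro sigma_finite_radial_measure sigma_finite_measure_axioms)

lemma space_kappa: "space \<kappa> = sphere 0 1"
  using sets_eq_imp_space_eq[OF sets_kappa] by simp

lemma measurable_kappa_ident [measurable]: "(\<lambda>x. x) \<in> \<kappa> \<rightarrow>\<^sub>M borel"
  using measurable_sphere_borel by (simp cong: measurable_cong_sets add: sets_kappa)

lemma measurable_polar [measurable]: "(\<lambda>(r, \<theta>). r *\<^sub>R \<theta>) \<in> radial_measure s \<Otimes>\<^sub>M \<kappa> \<rightarrow>\<^sub>M borel"
proof -
  have [measurable]: "snd \<in> radial_measure s \<Otimes>\<^sub>M \<kappa> \<rightarrow>\<^sub>M borel"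
    using measurable_compose[OF measurable_snd measurable_kappa_ident] by simp
  show ?thesis by measurable
qed

lemma kernel_measure_eq: "kernel_measure s \<kappa> = distr (radial_measure s \<Otimes>\<^sub>M \<kappa>) borel (\<lambda>(r, \<theta>). r *\<^sub>R \<theta>)"
  by (simp add: kernel_measure_def radial_measure_def)

lemma nn_integral_kernel_measure:
  assumes [measurable]: "f \<in> borel_measurable borel"
  shows "(\<integral>\<^sup>+y. f y \<partial>kernel_measure s \<kappa>) =
    (\<integral>\<^sup>+\<theta>. \<integral>\<^sup>+r. ennreal (indicator {0<..} r * r powr (- 1 - 2 * s)) * f (r *\<^sub>R \<theta>) \<partial>lborel \<partial>\<kappa>)"
proof -
  have "(\<integral>\<^sup>+y. f y \<partial>kernel_measure s \<kappa>) = (\<integral>\<^sup>+z. f (case z of (r, \<theta>) \<Rightarrow> r *\<^sub>R \<theta>) \<partial>(radial_measure s \<Otimes>\<^sub>M \<kappa>))"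
    unfolding kernel_measure_eq by (rule nn_integral_distr) auto
  also have "\<dots> = (\<integral>\<^sup>+\<theta>. \<integral>\<^sup>+r. f (r *\<^sub>R \<theta>) \<partial>radial_measure s \<partial>\<kappa>)"
    by (subst polar.nn_integral_snd[symmetric]) auto
  also have "\<dots> = (\<integral>\<^sup>+\<theta>. \<integral>\<^sup>+r. ennreal (indicator {0<..} r * r powr (- 1 - 2 * s)) * f (r *\<^sub>R \<theta>) \<partial>lborel \<partial>\<kappa>)"
    unfolding radial_measure_def by (intro nn_integral_cong nn_integral_density) auto
  finally show ?thesis .
qed

text \<open>Along each ray the kernel has density r^(-1-2s): the condition 2s < p makes r^(p-1-2s)
  integrable at 0, and q < 2s makes r^(q-1-2s) integrable at infinity. The bound is the same on all
  rays and the spherical measure is finite.\<close>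

lemma nn_integral_weight_finite:
  assumes "2 * s < real p" "real q < 2 * s"
  shows "(\<integral>\<^sup>+y. ennreal (weight p q y) \<partial>kernel_measure s \<kappa>) < \<infinity>"
proof -
  have restrict_eq: "(\<lambda>r::real. indicator A r * g r :: real) = (\<lambda>r. if r \<in> A then g r else 0)" for A g
    by (auto simp: fun_eq_iff)
  define I where "I = (\<integral>\<^sup>+r. ennreal (indicator {0..1} r * r powr (- 1 - 2 * s + real p)) \<partial>lborel)
    + (\<integral>\<^sup>+r. ennreal (indicator {1..} r * r powr (- 1 - 2 * s + real q)) \<partial>lborel)"
  have "((\<lambda>r. indicator {0..1} r * r powr (- 1 - 2 * s + real p)) has_integral 1 / (real p - 2 * s)) UNIV"
    using has_integral_powr_from_0[of "- 1 - 2 * s + real p" 1] assms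
    by (subst restrict_eq, subst has_integral_restrict_UNIV) simp
  from nn_integral_has_integral_lborel[OF _ _ this]
  have "(\<integral>\<^sup>+r. ennreal (indicator {0..1} r * r powr (- 1 - 2 * s + real p)) \<partial>lborel) < \<infinity>" by simp
  moreover have "((\<lambda>r. indicator {1..} r * r powr (- 1 - 2 * s + real q)) has_integral - 1 / (real q - 2 * s)) UNIV"
    using has_integral_powr_to_inf[of "- 1 - 2 * s + real q" 1] assms
    by (subst restrict_eq, subst has_integral_restrict_UNIV) simp
  from nn_integral_has_integral_lborel[OF _ _ this]
  have "(\<integral>\<^sup>+r. ennreal (indicator {1..} r * r powr (- 1 - 2 * s + real q)) \<partial>lborel) < \<infinity>" by simp
  ultimately have I: "I < \<infinity>" by (simp add: I_def)
  have "(\<integral>\<^sup>+r. ennreal (indicator {0<..} r * r powr (- 1 - 2 * s)) * ennreal (weight p q (r *\<^sub>R \<theta>)) \<partial>lborel) \<le> I"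
    if "\<theta> \<in> space \<kappa>" for \<theta>
  proof -
    have "norm \<theta> = 1" using that by (simp add: space_kappa)
    then have "ennreal (indicator {0<..} r * r powr (- 1 - 2 * s)) * ennreal (weight p q (r *\<^sub>R \<theta>))
      \<le> ennreal (indicator {0..1} r * r powr (- 1 - 2 * s + real p)) + ennreal (indicator {1..} r * r powr (- 1 - 2 * s + real q))" for r
      by (cases "r > 0"; cases "r \<le> 1")
        (auto simp: weight_def indicator_def powr_add[symmetric] simp flip: ennreal_mult powr_realpow intro!: ennreal_leI)
    then show ?thesis
      unfolding I_def by (subst nn_integral_add[symmetric]) (auto intro!: nn_integral_mono)
  qed
  then have "(\<integral>\<^sup>+y. ennreal (weight p q y) \<partial>kernel_measure s \<kappa>) \<le> (\<integral>\<^sup>+\<theta>. I \<partial>\<kappa>)"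
    by (subst nn_integral_kernel_measure) (simp, rule nn_integral_mono)
  also have "\<dots> < \<infinity>"
  proof -
    have "emeasure \<kappa> (space \<kappa>) < top" by (simp add: less_top[symmetric])
    then show ?thesis using I by (simp only: nn_integral_const ennreal_mult_less_top infinity_ennreal_def simp_thms)
  qed
  finally show ?thesis .
qed

lemma integrable_weight:
  assumes "2 * s < real p" "real q < 2 * s"
  shows "integrable (kernel_measure s \<kappa>) (weight p q)"
  using nn_integral_weight_finite[OF assms]
  by (intro integrableI_nonneg) (auto simp: weight_nonneg)

lemma emeasure_kernel_measure_0: "emeasure (kernel_measure s \<kappa>) {0} = 0"
proof -
  have "emeasure (kernel_measure s \<kappa>) {0} = (\<integral>\<^sup>+y. indicator {0} y \<partial>kernel_measure s \<kappa>)"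
    by simp
  also have "\<dots> = (\<integral>\<^sup>+\<theta>. \<integral>\<^sup>+r. ennreal (indicator {0<..} r * r powr (- 1 - 2 * s)) * indicator {0} (r *\<^sub>R \<theta>) \<partial>lborel \<partial>\<kappa>)"
    by (intro nn_integral_kernel_measure) auto
  also have "\<dots> = (\<integral>\<^sup>+\<theta>. \<integral>\<^sup>+(r::real). 0 \<partial>lborel \<partial>\<kappa>)"
  proof (intro nn_integral_cong)
    fix \<theta> r assume "\<theta> \<in> space \<kappa>"
    then have "norm \<theta> = 1" by (simp add: space_kappa)
    then show "ennreal (indicator {0<..} r * r powr (- 1 - 2 * s)) * indicator {0} (r *\<^sub>R \<theta>) = 0"
      by (auto simp: indicator_def)
  qed
  finally show ?thesis by simp
qed

text \<open>Chebyshev's inequality against \<open>weight p 0\<close>, with p large enough for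
  integrability at the origin; the far exponent 0 is admissible because s > 0.\<close>

lemma emeasure_kernel_measure_outside_finite:
  assumes "e > 0"
  shows "emeasure (kernel_measure s \<kappa>) {y. e < norm y} < \<infinity>"
proof -
  obtain p :: nat where p: "2 * s < real p" using reals_Archimedean2 by blast
  \<comment> \<open>A lower bound of \<open>weight p 0\<close> outside the ball of radius e: the
    power up to radius 1, the constant 1 beyond.\<close>
  define m where "m = min (e ^ p) 1"
  have m: "m > 0" using assms by (simp add: m_def)
  have *: "1 \<le> weight p 0 y / m" if "e < norm y" for y :: 'a
  proof -
    have "m \<le> weight p 0 y"
      using power_mono[of e "norm y" p] that assms by (auto simp: m_def weight_def)
    then show ?thesis using m by simp
  qed
  have "emeasure (kernel_measure s \<kappa>) {y. e < norm y} = (\<integral>\<^sup>+y. indicator {y. e < norm y} y \<partial>kernel_measure s \<kappa>)"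
    by (subst nn_integral_indicator) auto
  also have "\<dots> \<le> (\<integral>\<^sup>+y. ennreal (1 / m) * ennreal (weight p 0 y) \<partial>kernel_measure s \<kappa>)"
    using * m weight_nonneg
    by (intro nn_integral_mono) (auto simp: indicator_def ennreal_mult'[symmetric] simp flip: ennreal_1 intro!: ennreal_leI)
  also have "\<dots> = ennreal (1 / m) * (\<integral>\<^sup>+y. ennreal (weight p 0 y) \<partial>kernel_measure s \<kappa>)"
    by (intro nn_integral_cmult) auto
  also have "\<dots> < \<infinity>"
    using nn_integral_weight_finite[of p 0] p s_pos by (simp add: ennreal_mult_less_top)
  finally show ?thesis .
qed

text \<open>The mass near the origin is in general infinite; complements of balls of radius 1/(n +
  1), together with the null set {0}, exhaust the space. Fubini's theorem depends on this.\<close>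

lemma sigma_finite_kernel_measure: "sigma_finite_measure (kernel_measure s \<kappa>)"
proof
  define A where "A = insert {0} (range (\<lambda>n. {y::'a. inverse (real (Suc n)) < norm y}))"
  have "\<exists>n. inverse (real (Suc n)) < norm y" if "y \<noteq> 0" for y :: 'a
    using reals_Archimedean that by (metis zero_less_norm_iff)
  then have "\<Union>A = UNIV" by (auto simp: A_def)
  moreover have "emeasure (kernel_measure s \<kappa>) a \<noteq> \<infinity>" if "a \<in> A" for a
    using that emeasure_kernel_measure_0 emeasure_kernel_measure_outside_finite
    by (auto simp: A_def simp del: of_nat_Suc) (metis inverse_positive_iff_positive less_irrefl of_nat_0_less_iff zero_less_Suc)
  moreover have "A \<subseteq> sets (kernel_measure s \<kappa>)" by (auto simp: A_def)
  ultimately show "\<exists>A. countable A \<and> A \<subseteq> sets (kernel_measure s \<kappa>) \<and> \<Union> A = space (kernel_measure s \<kappa>) \<and>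
      (\<forall>a\<in>A. emeasure (kernel_measure s \<kappa>) a \<noteq> \<infinity>)"
    by (intro exI[of _ A]) (auto simp: A_def)
qed

text \<open>In polar coordinates the integral factors into a radial constant and the mean of
  \<open>\<theta>\<close>, so the cancellation condition on the sphere passes to every
  annulus.\<close>

lemma integral_annulus_eq_0:
  assumes "(LINT \<theta>|\<kappa>. \<theta>) = 0"
  shows "(LINT y|kernel_measure s \<kappa>. indicator {y. e < norm y \<and> norm y \<le> 1} y * (y \<bullet> v)) = 0"
proof -
  let ?f = "\<lambda>r \<theta>. indicator {y. e < norm y \<and> norm y \<le> 1} (r *\<^sub>R \<theta>) * (r *\<^sub>R \<theta> \<bullet> v)"
  define c where "c = (LINT r|radial_measure s. indicator {r. e < \<bar>r\<bar> \<and> \<bar>r\<bar> \<le> 1} r * r)"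
  have int: "integrable \<kappa> (\<lambda>\<theta>. \<theta>)"
    by (rule integrable_const_bound[of _ 1]) (auto simp: space_kappa)
  have "(LINT y|kernel_measure s \<kappa>. indicator {y. e < norm y \<and> norm y \<le> 1} y * (y \<bullet> v)) =
    (LINT z|(radial_measure s \<Otimes>\<^sub>M \<kappa>). (case z of (r, \<theta>) \<Rightarrow> ?f r \<theta>))"
    unfolding kernel_measure_eq by (subst integral_distr) (auto simp: split_beta' intro!: Bochner_Integration.integral_cong)
  also have "\<dots> = 0"
  \<comment> \<open>For e \<le> 0 the integrand may fail to be integrable; the Bochner integral is
    then 0 by convention, so that e can be arbitrary.\<close>
  proof (cases "integrable (radial_measure s \<Otimes>\<^sub>M \<kappa>) (\<lambda>(r, \<theta>). ?f r \<theta>)")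
    case True
    from polar.integral_snd[OF this]
    have "(LINT z|(radial_measure s \<Otimes>\<^sub>M \<kappa>). (case z of (r, \<theta>) \<Rightarrow> ?f r \<theta>)) = (LINT \<theta>|\<kappa>. LINT r|radial_measure s. ?f r \<theta>)"
      by simp
    also have "\<dots> = (LINT \<theta>|\<kappa>. c * (\<theta> \<bullet> v))"
    proof (intro Bochner_Integration.integral_cong refl)
      fix \<theta> assume "\<theta> \<in> space \<kappa>"
      then have "norm \<theta> = 1" by (simp add: space_kappa)
      then have eq: "?f r \<theta> = indicator {r. e < \<bar>r\<bar> \<and> \<bar>r\<bar> \<le> 1} r * r * (\<theta> \<bullet> v)" for r
        by (simp add: indicator_def)
      then show "(LINT r|radial_measure s. ?f r \<theta>) = c * (\<theta> \<bullet> v)"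
        by (simp only: eq c_def integral_mult_left_zero)
    qed
    also have "\<dots> = c * ((LINT \<theta>|\<kappa>. \<theta>) \<bullet> v)"
      using int by simp
    finally show ?thesis using assms by simp
  qed (simp add: not_integrable_integral_eq)
  finally show ?thesis .
qed

text \<open>The support of the kernel is the cone over the support of the spherical measure: a small
  sector around the point \<open>t *\<^sub>R \<theta>0\<close> fits into the ball, and both its
  radial and its angular factor have positive mass.\<close>

lemma emeasure_kernel_measure_ball_pos:
  assumes \<theta>0: "\<And>r. r > 0 \<Longrightarrow> emeasure \<kappa> (ball \<theta>0 r \<inter> sphere 0 1) > 0"
    and n: "norm \<theta>0 = 1" and t: "t > 0" and r: "r > 0"
  shows "emeasure (kernel_measure s \<kappa>) (ball (t *\<^sub>R \<theta>0) r) > 0"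
proof -
  define w where "w = (\<lambda>\<rho>. ennreal (indicator {0<..} \<rho> * \<rho> powr (- 1 - 2 * s)) * indicator {t<..<t + r / 2} \<rho>)"
  define K where "K = (\<integral>\<^sup>+\<rho>. w \<rho> \<partial>lborel)"
  have [measurable]: "w \<in> borel_measurable borel" unfolding w_def by measurable
  have "K \<noteq> 0"
  proof
    assume "K = 0"
    then have "AE \<rho> in lborel. w \<rho> = 0"
      unfolding K_def by (subst (asm) nn_integral_0_iff_AE) auto
    then have "AE \<rho> in lborel. \<rho> \<notin> {t<..<t + r / 2}"
      by eventually_elim (use t in \<open>auto simp: w_def indicator_def split: if_splits\<close>)
    then have "emeasure lborel {t<..<t + r / 2} = 0"
      by (subst (asm) AE_iff_measurable[of "{t<..<t + r / 2}"]) auto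
    then show False using r by simp
  qed
  \<comment> \<open>With this angular radius the displacement t |\<theta>0 - \<theta>| is below r/2;
    the radial interval of length r/2 contributes the other half.\<close>
  have sub: "ball \<theta>0 (r / (2 * t)) \<inter> sphere 0 1 \<in> sets \<kappa>"
    by (simp add: sets_kappa ball_Int_sphere_sets)
  have "0 < K * emeasure \<kappa> (ball \<theta>0 (r / (2 * t)) \<inter> sphere 0 1)"
    using \<open>K \<noteq> 0\<close> \<theta>0[of "r / (2 * t)"] r t by (simp add: zero_less_iff_neq_zero)
  also have "\<dots> = (\<integral>\<^sup>+\<theta>. K * indicator (ball \<theta>0 (r / (2 * t)) \<inter> sphere 0 1) \<theta> \<partial>\<kappa>)"
    using sub by (simp add: nn_integral_cmult_indicator)
  also have "\<dots> \<le> (\<integral>\<^sup>+\<theta>. \<integral>\<^sup>+\<rho>. ennreal (indicator {0<..} \<rho> * \<rho> powr (- 1 - 2 * s)) * indicator (ball (t *\<^sub>R \<theta>0) r) (\<rho> *\<^sub>R \<theta>) \<partial>lborel \<partial>\<kappa>)"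
  proof (rule nn_integral_mono)
    fix \<theta> assume "\<theta> \<in> space \<kappa>"
    then have n1: "norm \<theta> = 1" by (simp add: space_kappa)
    show "K * indicator (ball \<theta>0 (r / (2 * t)) \<inter> sphere 0 1) \<theta> \<le>
      (\<integral>\<^sup>+\<rho>. ennreal (indicator {0<..} \<rho> * \<rho> powr (- 1 - 2 * s)) * indicator (ball (t *\<^sub>R \<theta>0) r) (\<rho> *\<^sub>R \<theta>) \<partial>lborel)"
    proof (cases "\<theta> \<in> ball \<theta>0 (r / (2 * t))")
      case True
      have "\<rho> *\<^sub>R \<theta> \<in> ball (t *\<^sub>R \<theta>0) r" if \<rho>: "\<rho> \<in> {t<..<t + r / 2}" for \<rho>
      proof -
        have "t *\<^sub>R \<theta>0 - \<rho> *\<^sub>R \<theta> = t *\<^sub>R (\<theta>0 - \<theta>) + (t - \<rho>) *\<^sub>R \<theta>"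
          by (simp add: algebra_simps)
        then have "norm (t *\<^sub>R \<theta>0 - \<rho> *\<^sub>R \<theta>) \<le> t * norm (\<theta>0 - \<theta>) + \<bar>t - \<rho>\<bar>"
          using norm_triangle_ineq[of "t *\<^sub>R (\<theta>0 - \<theta>)" "(t - \<rho>) *\<^sub>R \<theta>"] n1 t by simp
        also have "t * norm (\<theta>0 - \<theta>) < r / 2"
          using True t by (simp add: dist_norm field_simps)
        finally show ?thesis using \<rho> by (auto simp: dist_norm)
      qed
      then have "w \<rho> \<le> ennreal (indicator {0<..} \<rho> * \<rho> powr (- 1 - 2 * s)) * indicator (ball (t *\<^sub>R \<theta>0) r) (\<rho> *\<^sub>R \<theta>)" for \<rho>
        unfolding w_def by (intro mult_left_mono) (auto simp: indicator_def)
      then show ?thesis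
        unfolding K_def using n1 True by (auto intro!: nn_integral_mono)
    qed simp
  qed
  also have "\<dots> = (\<integral>\<^sup>+y. indicator (ball (t *\<^sub>R \<theta>0) r) y \<partial>kernel_measure s \<kappa>)"
    by (intro nn_integral_kernel_measure[symmetric] borel_measurable_indicator) auto
  finally show ?thesis by simp
qed

end

text \<open>The polar map commutes with the reflection, r (-\<theta>) = -(r \<theta>), so the
  iterated integrals of an indicator agree.\<close>

lemma spherical_kernel_reflect:
  assumes "spherical_kernel s \<kappa>"
  shows "spherical_kernel s (reflect_measure \<kappa>)"
    and "kernel_measure s (reflect_measure \<kappa>) = distr (kernel_measure s \<kappa>) borel uminus"
proof -
  interpret spherical_kernel s \<kappa> by fact
  have um [measurable]: "uminus \<in> \<kappa> \<rightarrow>\<^sub>M sphere_borel"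
    unfolding sphere_borel_def
  proof (rule measurable_restrict_space2)
    show "uminus \<in> \<kappa> \<rightarrow>\<^sub>M borel"
      using measurable_compose[OF measurable_kappa_ident, of uminus borel] by simp
  qed (simp add: space_kappa)
  show 1: "spherical_kernel s (reflect_measure \<kappa>)"
    unfolding reflect_measure_def
    by (rule spherical_kernel.intro[OF _ finite_measure_distr[OF um] s_pos]) simp
  show "kernel_measure s (reflect_measure \<kappa>) = distr (kernel_measure s \<kappa>) borel uminus"
  proof (rule measure_eqI)
    fix A :: "'a set" assume "A \<in> sets (kernel_measure s (reflect_measure \<kappa>))"
    then have A [measurable]: "A \<in> sets borel" by simp
    let ?w = "\<lambda>r. ennreal (indicator {0<..} r * r powr (- 1 - 2 * s))"
    have [measurable]: "snd \<in> borel_measurable (borel \<Otimes>\<^sub>M sphere_borel)" "fst \<in> borel_measurable (sphere_borel \<Otimes>\<^sub>M borel)"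
      using measurable_compose[OF measurable_snd measurable_sphere_borel] measurable_compose[OF measurable_fst measurable_sphere_borel] by auto
    have "emeasure (kernel_measure s (reflect_measure \<kappa>)) A = (\<integral>\<^sup>+y. indicator A y \<partial>kernel_measure s (reflect_measure \<kappa>))"
      by simp
    also have "\<dots> = (\<integral>\<^sup>+\<theta>. \<integral>\<^sup>+r. ?w r * indicator A (r *\<^sub>R \<theta>) \<partial>lborel \<partial>reflect_measure \<kappa>)"
      by (rule spherical_kernel.nn_integral_kernel_measure[OF 1]) simp
    also have "\<dots> = (\<integral>\<^sup>+\<theta>. \<integral>\<^sup>+r. ?w r * indicator A (r *\<^sub>R (- \<theta>)) \<partial>lborel \<partial>\<kappa>)"
      unfolding reflect_measure_def
    proof (rule nn_integral_distr)
      show "uminus \<in> \<kappa> \<rightarrow>\<^sub>M sphere_borel" by (rule um)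
      show "(\<lambda>\<theta>. \<integral>\<^sup>+r. ?w r * indicator A (r *\<^sub>R \<theta>) \<partial>lborel) \<in> borel_measurable (distr \<kappa> sphere_borel uminus)"
        by measurable
    qed
    also have "\<dots> = (\<integral>\<^sup>+\<theta>. \<integral>\<^sup>+r. ?w r * indicator A (- (r *\<^sub>R \<theta>)) \<partial>lborel \<partial>\<kappa>)"
      by simp
    also have "\<dots> = (\<integral>\<^sup>+y. indicator A (- y) \<partial>kernel_measure s \<kappa>)"
      by (rule nn_integral_kernel_measure[symmetric]) simp
    also have "\<dots> = emeasure (distr (kernel_measure s \<kappa>) borel uminus) A"
      by (simp add: nn_integral_distr flip: nn_integral_indicator)
    finally show "emeasure (kernel_measure s (reflect_measure \<kappa>)) A = emeasure (distr (kernel_measure s \<kappa>) borel uminus) A" .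
  qed simp
qed

text \<open>If v were orthogonal to the support, |v \<bullet> \<theta>| would vanish almost
  everywhere, and the infimum in the nondegeneracy condition, bounded by its value at v, could not
  reach the positive constant \<open>lam\<close>.\<close>

lemma admissible_support_spanning:
  assumes "spherical_kernel s \<kappa>" and adm: "admissible lam Lam s \<kappa> b" and "lam > 0" and v: "norm v = 1"
  obtains \<theta>0 where "norm \<theta>0 = 1" "v \<bullet> \<theta>0 \<noteq> 0"
    "\<And>r. r > 0 \<Longrightarrow> emeasure \<kappa> (ball \<theta>0 r \<inter> sphere 0 1) > 0"
proof (rule ccontr)
  interpret spherical_kernel s \<kappa> by fact
  note witness = that
  assume "\<not> thesis"
  then have *: "\<exists>r>0. emeasure \<kappa> (ball \<theta> r \<inter> sphere 0 1) = 0" if "norm \<theta> = 1" "v \<bullet> \<theta> \<noteq> 0" for \<theta>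
    using witness[OF that] \<open>\<not> thesis\<close> by (auto simp: zero_less_iff_neq_zero)
  define F where "F = {U. \<exists>\<theta> r. U = ball \<theta> r \<and> emeasure \<kappa> (U \<inter> sphere 0 1) = 0}"
  \<comment> \<open>Each direction not orthogonal to v has a null neighbourhood; Lindelof's theorem
    replaces this uncountable family by a countable one, whose union is null.\<close>
  obtain F' where F': "F' \<subseteq> F" "countable F'" "\<Union>F' = \<Union>F"
    using Lindelof[of F] by (auto simp: F_def)
  have "(\<Union>U\<in>F'. U \<inter> sphere 0 1) \<in> null_sets \<kappa>"
    using F' by (intro null_sets_UN') (auto simp: F_def null_sets_def sets_kappa ball_Int_sphere_sets)
  then have "AE \<theta> in \<kappa>. \<theta> \<notin> (\<Union>U\<in>F'. U \<inter> sphere 0 1)"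
    by (rule AE_not_in)
  then have "AE \<theta> in \<kappa>. \<bar>v \<bullet> \<theta>\<bar> powr (2 * s) = 0"
  proof (rule AE_mp, intro AE_I2 impI)
    fix \<theta> assume \<theta>: "\<theta> \<in> space \<kappa>" "\<theta> \<notin> (\<Union>U\<in>F'. U \<inter> sphere 0 1)"
    have "v \<bullet> \<theta> = 0"
    proof (rule ccontr)
      assume "v \<bullet> \<theta> \<noteq> 0"
      then obtain r where "r > 0" "emeasure \<kappa> (ball \<theta> r \<inter> sphere 0 1) = 0"
        using * \<theta> by (auto simp: space_kappa)
      then have "\<theta> \<in> \<Union>F" unfolding F_def by (auto intro!: exI[of _ "ball \<theta> r"])
      then show False using \<theta> F' by (auto simp: space_kappa)
    qed
    then show "\<bar>v \<bullet> \<theta>\<bar> powr (2 * s) = 0" by simp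
  qed
  then have "(LINT \<theta>|\<kappa>. \<bar>v \<bullet> \<theta>\<bar> powr (2 * s)) = 0"
    by (rule integral_eq_zero_AE)
  moreover have "(INF \<nu>\<in>sphere 0 1. LINT \<theta>|\<kappa>. \<bar>\<nu> \<bullet> \<theta>\<bar> powr (2 * s)) \<le> (LINT \<theta>|\<kappa>. \<bar>v \<bullet> \<theta>\<bar> powr (2 * s))"
    using v by (intro cINF_lower bdd_belowI[of _ 0]) auto
  ultimately show False using adm \<open>lam > 0\<close> by (simp add: admissible_def)
qed

section \<open>The adjoint operator on test functions\<close>

definition near_exp :: "real \<Rightarrow> nat" where
  "near_exp s = (if s < 1/2 then 1 else 2)"

definition far_exp :: "real \<Rightarrow> nat" where
  "far_exp s = (if s \<le> 1/2 then 0 else 1)"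

lemma near_exp_cases: "near_exp s = 1 \<or> near_exp s = 2"
  and far_exp_cases: "far_exp s = 0 \<or> far_exp s = 1"
  by (auto simp: near_exp_def far_exp_def)

lemma near_far_exp:
  assumes "0 < s" "s < 1"
  shows "2 * s < real (near_exp s)" "real (far_exp s) < 2 * s"
  using assms by (auto simp: near_exp_def far_exp_def)

lemma increment_le_weight:
  assumes "test_function UNIV f" "p = 1 \<or> p = 2" "q = 0 \<or> q = 1"
  obtains C where "0 \<le> C" "\<And>y w. \<bar>increment p q f y w\<bar> \<le> C * weight p q y"
proof -
  obtain C R where C: "0 \<le> C"
    "\<And>y w. \<bar>increment p q f y w\<bar> \<le> C * weight p q y * (indicator (cball 0 R) w + indicator (cball 0 R) (w - y))"
    using increment_bound[OF assms] by metis
  have "\<bar>increment p q f y w\<bar> \<le> 2 * C * weight p q y" for y w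
  proof -
    have "C * weight p q y * (indicator (cball 0 R) w + indicator (cball 0 R) (w - y)) \<le> C * weight p q y * 2"
      using C(1) weight_nonneg[of p q y] by (intro mult_left_mono) (auto simp: indicator_def)
    then show ?thesis using C(2)[of y w] by simp
  qed
  then show thesis using that[of "2 * C"] C(1) by simp
qed

lemma borel_measurable_increment [measurable (raw)]:
  assumes f: "test_function UNIV f"
  shows "(\<lambda>y. increment p q f y w) \<in> borel_measurable borel"
    and "increment p q f y \<in> borel_measurable borel"
  using measurable_compose[OF measurable_Pair[OF measurable_ident measurable_const[of w]] borel_measurable_increment_pair[OF f, of p q]]
    measurable_compose[OF measurable_Pair[OF measurable_const[of y] measurable_ident] borel_measurable_increment_pair[OF f, of p q]]
  by (simp_all add: comp_def)

lemma frechet_derivative_eq_inner: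
  assumes "test_function UNIV f"
  shows "frechet_derivative f (at x) y = y \<bullet> (\<Sum>i\<in>Basis. frechet_derivative f (at x) i *\<^sub>R i)"
  by (subst frechet_derivative_eq_sum[OF assms]) (simp add: inner_sum_right mult.commute)

context spherical_kernel
begin

lemma integrable_increment:
  assumes "test_function UNIV f" and "2 * s < real p" "real q < 2 * s"
    and "p = 1 \<or> p = 2" "q = 0 \<or> q = 1"
  shows "integrable (kernel_measure s \<kappa>) (\<lambda>y. increment p q f y w)"
proof -
  obtain C where C: "0 \<le> C" "\<And>y w. \<bar>increment p q f y w\<bar> \<le> C * weight p q y"
    using increment_le_weight assms by metis
  show ?thesis
  proof (rule Bochner_Integration.integrable_bound)
    show "integrable (kernel_measure s \<kappa>) (\<lambda>y. C * weight p q y)"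
      using integrable_weight assms by simp
    show "AE y in kernel_measure s \<kappa>. norm (increment p q f y w) \<le> norm (C * weight p q y)"
      using C order_trans[OF C(2) abs_ge_self] by simp
    show "(\<lambda>y. increment p q f y w) \<in> borel_measurable (kernel_measure s \<kappa>)"
      using borel_measurable_increment(1)[OF assms(1)] by simp
  qed
qed

text \<open>On the annulus between \<epsilon> and 1 the gradient term integrates to 0, so it can be
  inserted into each truncated integral. The compensated integrand is absolutely integrable, and
  dominated convergence removes the truncation.\<close>

lemma principal_value_eq:
  assumes f: "test_function UNIV f" and s: "s = 1/2" and mean: "(LINT \<theta>|\<kappa>. \<theta>) = 0"
  shows "((\<lambda>\<epsilon>. LINT y:{y. \<epsilon> < norm y}|kernel_measure s \<kappa>. f x - f (x - y)) \<longlongrightarrow>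
    (LINT y|kernel_measure s \<kappa>. increment 2 0 f y x)) (at_right 0)"
proof -
  note [measurable] = borel_measurable_increment(1)[OF f, of 2 0 x]
  let ?N = "kernel_measure s \<kappa>"
  let ?D = "frechet_derivative f (at x)"
  let ?v = "\<Sum>i\<in>Basis. ?D i *\<^sub>R i"
  have w: "integrable ?N (weight 2 0)" using s by (intro integrable_weight) auto
  obtain C where C: "0 \<le> C" "\<And>y w. \<bar>increment 2 0 f y w\<bar> \<le> C * weight 2 0 y"
    using increment_le_weight[OF f, of 2 0] by auto
  have int: "integrable ?N (\<lambda>y. increment 2 0 f y x)"
    using f s by (intro integrable_increment) auto
  have trunc: "(LINT y:{y. \<epsilon> < norm y}|?N. f x - f (x - y)) = (LINT y|?N. indicator {y. \<epsilon> < norm y} y * increment 2 0 f y x)"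
    if \<epsilon>: "0 < \<epsilon>" "\<epsilon> < 1" for \<epsilon>
  proof -
    have i1: "integrable ?N (\<lambda>y. indicator {y. \<epsilon> < norm y} y * increment 2 0 f y x)"
      by (rule Bochner_Integration.integrable_bound[OF int]) (auto simp: indicator_def)
    have i2: "integrable ?N (\<lambda>y. indicator {y. \<epsilon> < norm y \<and> norm y \<le> 1} y * (y \<bullet> ?v))"
    proof (rule Bochner_Integration.integrable_bound)
      \<comment> \<open>On the annulus |y| \<le> |y|^2 / \<epsilon>, so the linear term is dominated
        by the quadratic weight.\<close>
      show "integrable ?N (\<lambda>y. norm ?v / \<epsilon> * weight 2 0 y)" using w by simp
      have "\<bar>y \<bullet> ?v\<bar> \<le> norm ?v / \<epsilon> * weight 2 0 y" if "\<epsilon> < norm y" "norm y \<le> 1" for y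
      proof -
        have "\<bar>y \<bullet> ?v\<bar> \<le> norm ?v * norm y" using Cauchy_Schwarz_ineq2[of y ?v] by (simp add: mult.commute)
        also have "norm y \<le> norm y * norm y / \<epsilon>"
          using that \<epsilon> mult_right_mono[of \<epsilon> "norm y" "norm y"] by (simp add: field_simps)
        finally show ?thesis using that by (simp add: weight_def power2_eq_square mult_left_mono)
      qed
      then show "AE y in ?N. norm (indicator {y. \<epsilon> < norm y \<and> norm y \<le> 1} y * (y \<bullet> ?v)) \<le> norm (norm ?v / \<epsilon> * weight 2 0 y)"
        using \<epsilon> weight_nonneg[of 2 0 "_ :: 'a"] by (intro AE_I2) (auto simp: indicator_def abs_mult)
    qed simp
    have "(LINT y:{y. \<epsilon> < norm y}|?N. f x - f (x - y)) =
      (LINT y|?N. indicator {y. \<epsilon> < norm y} y * increment 2 0 f y x + indicator {y. \<epsilon> < norm y \<and> norm y \<le> 1} y * (y \<bullet> ?v))"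
      unfolding set_lebesgue_integral_def
      by (intro Bochner_Integration.integral_cong refl)
        (auto simp: increment_def grad_cutoff_def indicator_def frechet_derivative_eq_inner[OF f, symmetric])
    also have "\<dots> = (LINT y|?N. indicator {y. \<epsilon> < norm y} y * increment 2 0 f y x)"
      using i1 i2 integral_annulus_eq_0[OF mean, of \<epsilon> ?v] by simp
    finally show ?thesis .
  qed
  have "((\<lambda>\<epsilon>. LINT y|?N. indicator {y. \<epsilon> < norm y} y * increment 2 0 f y x) \<longlongrightarrow> (LINT y|?N. increment 2 0 f y x)) (at_right 0)"
    unfolding tendsto_at_iff_sequentially comp_def
  proof (intro allI impI)
    fix X :: "nat \<Rightarrow> real" assume X: "\<forall>i. X i \<in> {0<..} - {0}" "X \<longlonglongrightarrow> 0"
    show "(\<lambda>n. LINT y|?N. indicator {y. X n < norm y} y * increment 2 0 f y x) \<longlonglongrightarrow> (LINT y|?N. increment 2 0 f y x)"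
    proof (rule integral_dominated_convergence[where w = "\<lambda>y. \<bar>increment 2 0 f y x\<bar>"])
      show "AE y in ?N. (\<lambda>n. indicator {y. X n < norm y} y * increment 2 0 f y x) \<longlonglongrightarrow> increment 2 0 f y x"
      proof (rule AE_I2)
        fix y :: 'a
        show "(\<lambda>n. indicator {y. X n < norm y} y * increment 2 0 f y x) \<longlonglongrightarrow> increment 2 0 f y x"
        proof (cases "y = 0")
          case True
          then show ?thesis using C(2)[of 0 x] by (simp add: weight_def)
        next
          case False
          then have "eventually (\<lambda>n. X n < norm y) sequentially"
            using X(2) by (intro order_tendstoD) auto
          then have "eventually (\<lambda>n. increment 2 0 f y x = indicator {y. X n < norm y} y * increment 2 0 f y x) sequentially"
            by eventually_elim simp
          then show ?thesis
            by (rule Lim_transform_eventually[OF tendsto_const])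
        qed
      qed
    qed (use int in \<open>auto simp: indicator_def intro!: AE_I2\<close>)
  qed
  moreover have "eventually (\<lambda>\<epsilon>. (LINT y|?N. indicator {y. \<epsilon> < norm y} y * increment 2 0 f y x) =
      (LINT y:{y. \<epsilon> < norm y}|?N. f x - f (x - y))) (at_right 0)"
    using eventually_at_right_real[OF zero_less_one] by eventually_elim (simp add: trunc)
  ultimately show ?thesis
    by (rule Lim_transform_eventually)
qed

text \<open>One formula for the three ranges of s, from which all later arguments proceed without a
  case distinction. The minus sign of the last term comes from the reversed drift in the
  adjoint.\<close>

lemma adjoint_op_eq:
  assumes f: "test_function UNIV f" and mean: "s = 1/2 \<longrightarrow> (LINT \<theta>|\<kappa>. \<theta>) = 0"
  shows "adjoint_op s \<kappa> b f x =
    (LINT y|kernel_measure s \<kappa>. increment (near_exp s) (far_exp s) f y x)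
      - frechet_derivative f (at x) (if s = 1/2 then b else 0)"
proof -
  note [measurable] = test_function_borel[OF f]
  note lin = test_function_linear[OF f, of x]
  have refl: "kernel_measure s (reflect_measure \<kappa>) = distr (kernel_measure s \<kappa>) borel uminus"
    by (intro spherical_kernel_reflect spherical_kernel_axioms)
  have [measurable]: "frechet_derivative f (at x) \<in> borel_measurable borel"
    by (intro borel_measurable_continuous_onI linear_continuous_on linear_conv_bounded_linear[THEN iffD1] lin)
  consider "s < 1/2" | "s = 1/2" | "s > 1/2" by linarith
  then show ?thesis
  proof cases
    case 1
    then show ?thesis
      unfolding adjoint_op_def nonlocal_op_def refl
      by (subst integral_distr) (auto simp: increment_def grad_cutoff_def near_exp_def far_exp_def linear_0[OF lin])
  next
    case 2
    have "(LINT y:{y. \<epsilon> < norm y}|kernel_measure s (reflect_measure \<kappa>). f x - f (x + y)) =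
      (LINT y:{y. \<epsilon> < norm y}|kernel_measure s \<kappa>. f x - f (x - y))" for \<epsilon>
      unfolding refl set_lebesgue_integral_def
      by (subst integral_distr) (auto simp: indicator_def)
    note reflect = this
    have "Lim (at_right 0) (\<lambda>\<epsilon>. LINT y:{y. \<epsilon> < norm y}|kernel_measure s (reflect_measure \<kappa>). f x - f (x + y))
      = (LINT y|kernel_measure s \<kappa>. increment 2 0 f y x)"
      unfolding reflect by (intro tendsto_Lim principal_value_eq[OF f 2]) (use mean 2 in auto)
    then show ?thesis
      unfolding adjoint_op_def nonlocal_op_def
      by (simp add: 2 near_exp_def far_exp_def linear_neg[OF lin])
  next
    case 3
    then show ?thesis
      unfolding adjoint_op_def nonlocal_op_def refl
      by (subst integral_distr) (auto simp: increment_def grad_cutoff_def near_exp_def far_exp_def linear_0[OF lin] linear_neg[OF lin])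
  qed
qed

end

section \<open>Integration of increments over the base point\<close>

lemma lborel_integral_translate:
  fixes f :: "'a::euclidean_space \<Rightarrow> real"
  assumes [measurable]: "f \<in> borel_measurable borel"
  shows "(LINT w|lborel. f (w - y)) = (LINT w|lborel. f w)"
    and "integrable lborel (\<lambda>w. f (w - y)) \<longleftrightarrow> integrable lborel f"
proof -
  have "(LINT w|lborel. f w) = (LINT w|distr lborel borel ((+) (- y)). f w)"
    by (simp add: lborel_distr_plus)
  also have "\<dots> = (LINT w|lborel. f (w - y))"
    by (subst integral_distr) auto
  finally show "(LINT w|lborel. f (w - y)) = (LINT w|lborel. f w)" by simp
  have "integrable lborel f \<longleftrightarrow> integrable (distr lborel borel ((+) (- y))) f"
    by (simp add: lborel_distr_plus)
  also have "\<dots> \<longleftrightarrow> integrable lborel (\<lambda>w. f (w - y))"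
    by (subst integrable_distr_eq) auto
  finally show "integrable lborel (\<lambda>w. f (w - y)) \<longleftrightarrow> integrable lborel f" by simp
qed

lemma integrable_test_function:
  assumes f: "test_function UNIV f"
  shows "integrable lborel f"
proof -
  obtain R where R: "\<And>x. f x \<noteq> 0 \<Longrightarrow> norm x \<le> R"
    using f unfolding test_function_UNIV_iff bounded_iff by blast
  have "integrable lborel (\<lambda>x. indicator (cball 0 R) x *\<^sub>R f x)"
    using borel_integrable_compact[OF compact_cball continuous_on_subset[OF test_function_continuous[OF f]], of 0 R]
    by (simp add: indicator_def if_distrib[of "\<lambda>c. c *\<^sub>R _"] of_bool_def cong: if_cong)
  moreover have "(\<lambda>x. indicator (cball 0 R) x *\<^sub>R f x) = f"
    using R by (force simp: fun_eq_iff indicator_def)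
  ultimately show ?thesis by simp
qed

text \<open>Each of the two indicators in \<open>increment_bound\<close> integrates to the volume of
  the same ball, whatever y is. This leaves the weight, which the kernel integrates, and so supplies
  the hypothesis of Fubini's theorem.\<close>

lemma increment_L1_bound:
  assumes f: "test_function UNIV f" and pq: "p = 1 \<or> p = 2" "q = 0 \<or> q = 1"
  obtains C where "0 \<le> C" "\<And>y. integrable lborel (increment p q f y)"
    "\<And>y. (LINT w|lborel. \<bar>increment p q f y w\<bar>) \<le> C * weight p q y"
proof -
  obtain C R where C: "0 \<le> C"
    "\<And>y w. \<bar>increment p q f y w\<bar> \<le> C * weight p q y * (indicator (cball 0 R) w + indicator (cball 0 R) (w - y))"
    using increment_bound[OF assms] by metis
  let ?I = "indicator (cball (0::'a) R) :: 'a \<Rightarrow> real"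
  have I: "integrable lborel ?I"
    using emeasure_bounded_finite[OF bounded_cball, of "0::'a" R] by simp
  then have I': "integrable lborel (\<lambda>w. ?I (w - y))" for y
    by (subst lborel_integral_translate) auto
  have int: "integrable lborel (\<lambda>w. C * weight p q y * (?I w + ?I (w - y)))" for y
    using I I' by simp
  have inc: "integrable lborel (increment p q f y)" for y
    by (rule Bochner_Integration.integrable_bound[OF int])
      (use order_trans[OF C(2) abs_ge_self] borel_measurable_increment(2)[OF f] in auto)
  have "(LINT w|lborel. \<bar>increment p q f y w\<bar>) \<le> (C * (2 * (LINT w|lborel. ?I w))) * weight p q y" for y
  proof -
    have "(LINT w|lborel. \<bar>increment p q f y w\<bar>) \<le> (LINT w|lborel. C * weight p q y * (?I w + ?I (w - y)))"
      using inc by (intro integral_mono int C(2)) auto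
    also have "\<dots> = C * weight p q y * ((LINT w|lborel. ?I w) + (LINT w|lborel. ?I (w - y)))"
      using I I' by simp
    also have "(LINT w|lborel. ?I (w - y)) = (LINT w|lborel. ?I w)"
      by (intro lborel_integral_translate borel_measurable_indicator) simp
    finally show ?thesis by (simp add: mult_ac)
  qed
  then show thesis
    using C(1) inc by (intro that[of "C * (2 * (LINT w|lborel. ?I w))"]) auto
qed

section \<open>Mollifications of bounded solutions\<close>

text \<open>Here u is Borel and bounded everywhere, a representative chosen in the final proof, and
  the drift is normalized to 0 unless s = 1/2, so that the term with b can be written uniformly. The
  equation enters only through \<open>solution\<close>.\<close>

locale liouville = spherical_kernel s \<kappa> for s :: real and \<kappa> :: "'a::euclidean_space measure" +
  fixes u :: "'a \<Rightarrow> real" and B :: real and b :: 'a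
  assumes s_less_1: "s < 1"
    and mean_zero: "s = 1/2 \<longrightarrow> (LINT \<theta>|\<kappa>. \<theta>) = 0"
    and drift: "s \<noteq> 1/2 \<longrightarrow> b = 0"
    and u_measurable [measurable]: "u \<in> borel_measurable borel"
    and u_bounded: "\<bar>u x\<bar> \<le> B"
    and solution: "test_function UNIV f \<Longrightarrow> (LINT w|lborel. u w * adjoint_op s \<kappa> b f w) = 0"
begin

abbreviation "N \<equiv> kernel_measure s \<kappa>"
abbreviation "p \<equiv> near_exp s"
abbreviation "q \<equiv> far_exp s"

sublocale N: sigma_finite_measure N
  by (rule sigma_finite_kernel_measure)

sublocale NL: pair_sigma_finite N lborel
  by unfold_locales

lemma integrable_N_weight: "integrable N (weight p q)"
  by (intro integrable_weight near_far_exp s_pos s_less_1)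

definition pairing :: "('a \<Rightarrow> real) \<Rightarrow> real" where
  "pairing f = (LINT w|lborel. u w * f w)"

lemma B_nonneg: "0 \<le> B"
  using u_bounded[of 0] by linarith

lemma integrable_u_mult: "integrable lborel f \<Longrightarrow> integrable lborel (\<lambda>w. u w * f w)"
  by (rule Bochner_Integration.integrable_bound[of _ "\<lambda>w. B * f w"])
    (auto simp: abs_mult B_nonneg intro!: mult_right_mono u_bounded AE_I2)

lemma abs_pairing_le:
  assumes "integrable lborel f"
  shows "\<bar>pairing f\<bar> \<le> B * (LINT w|lborel. \<bar>f w\<bar>)"
proof -
  have "\<bar>pairing f\<bar> \<le> (LINT w|lborel. \<bar>u w * f w\<bar>)"
    unfolding pairing_def using integral_norm_bound[of lborel "\<lambda>w. u w * f w"] by simp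
  also have "\<dots> \<le> (LINT w|lborel. B * \<bar>f w\<bar>)"
    using assms integrable_u_mult[OF assms]
    by (intro integral_mono integrable_abs integrable_mult_right) (auto simp: abs_mult intro!: mult_right_mono u_bounded)
  finally show ?thesis by simp
qed

lemma pairing_diff:
  "integrable lborel f \<Longrightarrow> integrable lborel g \<Longrightarrow> pairing (\<lambda>w. f w - g w) = pairing f - pairing g"
  using integrable_u_mult[of f] integrable_u_mult[of g]
  by (simp add: pairing_def right_diff_distrib)

lemma pairing_cmult: "pairing (\<lambda>w. c * f w) = c * pairing f"
  unfolding pairing_def by (simp add: mult.left_commute[of "u _"])

lemma pairing_uminus: "pairing (\<lambda>w. - f w) = - pairing f"
  using pairing_cmult[of "-1" f] by simp

lemma pairing_sum:
  assumes "\<And>i. i \<in> I \<Longrightarrow> integrable lborel (f i)"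
  shows "pairing (\<lambda>w. \<Sum>i\<in>I. f i w) = (\<Sum>i\<in>I. pairing (f i))"
  unfolding pairing_def sum_distrib_left
  by (intro Bochner_Integration.integral_sum integrable_u_mult assms)

lemma integrable_frechet:
  "test_function UNIV f \<Longrightarrow> integrable lborel (\<lambda>w. frechet_derivative f (at w) v)"
  by (intro integrable_test_function test_function_frechet_derivative)

lemma pairing_increment_measurable:
  assumes "test_function UNIV f"
  shows "(\<lambda>y. pairing (increment p q f y)) \<in> borel_measurable borel"
proof -
  have [measurable]: "(\<lambda>x. increment p q f (fst x) (snd x)) \<in> borel_measurable (borel \<Otimes>\<^sub>M borel)"
    using borel_measurable_increment_pair[OF assms, of p q] by (simp add: case_prod_beta)
  show ?thesis
    unfolding pairing_def
    by (intro lborel.borel_measurable_lebesgue_integral) (simp add: case_prod_beta, measurable)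
qed

text \<open>Exchanging the integrals over y and w turns the weak equation into an identity for the
  increments. Applied to a translate of f, it says that the mollification of u solves the equation
  at one given point.\<close>

lemma integral_pairing_increment:
  assumes f: "test_function UNIV f"
  shows "(LINT y|N. pairing (increment p q f y)) = pairing (\<lambda>w. frechet_derivative f (at w) b)"
proof -
  have [measurable]: "(\<lambda>x. increment p q f (fst x) (snd x)) \<in> borel_measurable (borel \<Otimes>\<^sub>M borel)"
    using borel_measurable_increment_pair[OF f, of p q] by (simp add: case_prod_beta)
  obtain C where C: "0 \<le> C" "\<And>y. integrable lborel (increment p q f y)"
    "\<And>y. (LINT w|lborel. \<bar>increment p q f y w\<bar>) \<le> C * weight p q y"
    using increment_L1_bound[OF f near_exp_cases far_exp_cases] by metis
  have meas [measurable]: "(\<lambda>y. LINT w|lborel. \<bar>u w * increment p q f y w\<bar>) \<in> borel_measurable borel"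
    by (intro lborel.borel_measurable_lebesgue_integral) (simp add: case_prod_beta, measurable)
  \<comment> \<open>The inner integral over w is at most a multiple of the weight, which is
    integrable against the kernel.\<close>
  have int: "integrable (N \<Otimes>\<^sub>M lborel) (\<lambda>(y, w). u w * increment p q f y w)"
  proof (rule NL.Fubini_integrable)
    show "(\<lambda>(y, w). u w * increment p q f y w) \<in> borel_measurable (N \<Otimes>\<^sub>M lborel)"
      by measurable
    show "AE y in N. integrable lborel (\<lambda>w. case (y, w) of (y, w) \<Rightarrow> u w * increment p q f y w)"
      using C(2) integrable_u_mult by simp
    show "integrable N (\<lambda>y. LINT w|lborel. norm (case (y, w) of (y, w) \<Rightarrow> u w * increment p q f y w))"
    proof (rule Bochner_Integration.integrable_bound)
      show "integrable N (\<lambda>y. B * (C * weight p q y))" using integrable_N_weight by simp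
      have "(LINT w|lborel. \<bar>u w * increment p q f y w\<bar>) \<le> B * (C * weight p q y)" for y
      proof -
        have "(LINT w|lborel. \<bar>u w * increment p q f y w\<bar>) \<le> (LINT w|lborel. B * \<bar>increment p q f y w\<bar>)"
          using C(2)[of y] integrable_u_mult[OF C(2)[of y]]
          by (intro integral_mono integrable_abs integrable_mult_right) (auto simp: abs_mult intro!: mult_right_mono u_bounded)
        also have "\<dots> \<le> B * (C * weight p q y)"
          using C(3)[of y] B_nonneg by (simp add: mult_left_mono)
        finally show ?thesis .
      qed
      then show "AE y in N. norm (LINT w|lborel. norm (case (y, w) of (y, w) \<Rightarrow> u w * increment p q f y w)) \<le> norm (B * (C * weight p q y))"
        by (intro AE_I2) (auto intro: order_trans[OF _ abs_ge_self])
    qed (use meas in simp)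
  qed
  have I: "integrable lborel (\<lambda>w. LINT y|N. u w * increment p q f y w)"
    using NL.integrable_snd[OF int] by simp
  have "(LINT y|N. pairing (increment p q f y)) = (LINT w|lborel. LINT y|N. u w * increment p q f y w)"
    unfolding pairing_def using NL.Fubini_integral[OF int] by simp
  also have "\<dots> = (LINT w|lborel. u w * adjoint_op s \<kappa> b f w + u w * frechet_derivative f (at w) b)"
  proof (intro Bochner_Integration.integral_cong refl)
    fix w
    have "frechet_derivative f (at w) (if s = 1/2 then b else 0) = frechet_derivative f (at w) b"
      using drift by auto
    then show "(LINT y|N. u w * increment p q f y w) = u w * adjoint_op s \<kappa> b f w + u w * frechet_derivative f (at w) b"
      by (simp add: adjoint_op_eq[OF f mean_zero] right_diff_distrib)
  qed
  also have "\<dots> = pairing (\<lambda>w. frechet_derivative f (at w) b)"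
  proof -
    have D: "integrable lborel (\<lambda>w. u w * frechet_derivative f (at w) b)"
      by (intro integrable_u_mult integrable_frechet f)
    \<comment> \<open>Splitting the integral requires both summands to be integrable; for the
      adjoint term this is read off from Fubini's theorem.\<close>
    have "(\<lambda>w. u w * adjoint_op s \<kappa> b f w) =
      (\<lambda>w. (LINT y|N. u w * increment p q f y w) - u w * frechet_derivative f (at w) b)"
      using drift by (auto simp: fun_eq_iff adjoint_op_eq[OF f mean_zero] right_diff_distrib)
    then have "integrable lborel (\<lambda>w. u w * adjoint_op s \<kappa> b f w)"
      using I D by simp
    then show ?thesis using solution[OF f] D by (simp add: pairing_def)
  qed
  finally show ?thesis .
qed

section \<open>Mollifications as pairings with translated test functions\<close>

lemma increment_translate:
  assumes "test_function UNIV f"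
  shows "increment p' q' (translate x f) y w = increment p' q' f y (w - x)"
  unfolding increment_def test_function_frechet_derivative_translate[OF assms]
  by (simp add: translate_def algebra_simps)

text \<open>Increments commute with translations, hence K is uniform in x. The exponents are left
  free: besides those of the kernel, (1, 0) will give the Lipschitz bound and (2, 1) the Taylor
  bound of the mollification.\<close>

lemma abs_pairing_increment_le:
  assumes f: "test_function UNIV f" and pq: "p' = 1 \<or> p' = 2" "q' = 0 \<or> q' = 1"
  obtains K where "0 \<le> K" "\<And>x y. \<bar>pairing (increment p' q' (translate x f) y)\<bar> \<le> K * weight p' q' y"
proof -
  obtain C where C: "0 \<le> C" "\<And>y. integrable lborel (increment p' q' f y)"
    "\<And>y. (LINT w|lborel. \<bar>increment p' q' f y w\<bar>) \<le> C * weight p' q' y"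
    using increment_L1_bound[OF f pq] by metis
  have "\<bar>pairing (increment p' q' (translate x f) y)\<bar> \<le> B * C * weight p' q' y" for x y
  proof -
    have [measurable]: "increment p' q' f y \<in> borel_measurable borel"
      by (rule borel_measurable_increment[OF f])
    have eq: "increment p' q' (translate x f) y = (\<lambda>w. increment p' q' f y (w - x))"
      by (simp add: fun_eq_iff increment_translate[OF f])
    have "integrable lborel (increment p' q' (translate x f) y)"
      unfolding eq using C(2) by (subst lborel_integral_translate) auto
    then have "\<bar>pairing (increment p' q' (translate x f) y)\<bar> \<le> B * (LINT w|lborel. \<bar>increment p' q' f y (w - x)\<bar>)"
      using abs_pairing_le eq by simp
    also have "(LINT w|lborel. \<bar>increment p' q' f y (w - x)\<bar>) = (LINT w|lborel. \<bar>increment p' q' f y w\<bar>)"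
      by (rule lborel_integral_translate(1)[of "\<lambda>w. \<bar>increment p' q' f y w\<bar>"]) measurable
    also have "B * \<dots> \<le> B * (C * weight p' q' y)"
      using C(3) B_nonneg by (intro mult_left_mono)
    finally show ?thesis by (simp add: mult.assoc)
  qed
  then show thesis using B_nonneg C(1) by (intro that[of "B * C"]) auto
qed

text \<open>This is the convolution of u with the reflection of f. Accordingly
  \<open>mollified_grad f x y\<close> below is minus the derivative of this convolution at x in
  direction y, because x enters as w - x.\<close>

definition mollified :: "('a \<Rightarrow> real) \<Rightarrow> 'a \<Rightarrow> real" where
  "mollified f x = pairing (translate x f)"

definition mollified_grad :: "('a \<Rightarrow> real) \<Rightarrow> 'a \<Rightarrow> 'a \<Rightarrow> real" where
  "mollified_grad f x y = pairing (\<lambda>w. frechet_derivative (translate x f) (at w) y)"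

text \<open>Under the pairing the backward increment w - y of the test function becomes the forward
  increment x + y of the mollification; this is the passage from the adjoint back to the
  operator.\<close>

lemma pairing_increment_eq:
  assumes f: "test_function UNIV f"
  shows "pairing (increment p' q' (translate x f) y) =
    mollified f x - mollified f (x + y) - grad_cutoff p' q' y * mollified_grad f x y"
proof -
  note t = test_function_translate[OF f]
  have "increment p' q' (translate x f) y =
    (\<lambda>w. (translate x f w - translate (x + y) f w) - grad_cutoff p' q' y * frechet_derivative (translate x f) (at w) y)"
    by (simp add: fun_eq_iff increment_def) (simp add: translate_def algebra_simps)
  then show ?thesis
    using integrable_test_function[OF t] integrable_frechet[OF t]
    by (simp add: mollified_def mollified_grad_def pairing_diff pairing_cmult)
qed

lemma mollified_grad_eq_sum:
  assumes f: "test_function UNIV f"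
  shows "mollified_grad f x y = (\<Sum>i\<in>Basis. (y \<bullet> i) * mollified_grad f x i)"
  unfolding mollified_grad_def
  by (subst frechet_derivative_eq_sum[OF test_function_translate[OF f]], subst pairing_sum)
    (auto simp: pairing_cmult intro!: integrable_frechet test_function_translate f)

lemma mollified_grad_scaleR:
  assumes f: "test_function UNIV f"
  shows "mollified_grad f x (t *\<^sub>R y) = t * mollified_grad f x y"
  by (subst (1 2) mollified_grad_eq_sum[OF f]) (simp add: sum_distrib_left mult.assoc)

lemma mollified_bounded:
  assumes f: "test_function UNIV f"
  obtains K where "\<And>x. \<bar>mollified f x\<bar> \<le> K"
proof -
  note [measurable] = test_function_borel[OF f]
  have "\<bar>mollified f x\<bar> \<le> B * (LINT w|lborel. \<bar>f w\<bar>)" for x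
    using abs_pairing_le[OF integrable_test_function[OF test_function_translate[OF f, of x]]]
      lborel_integral_translate(1)[of "\<lambda>w. \<bar>f w\<bar>" x]
    by (simp add: mollified_def translate_def)
  then show thesis by (rule that)
qed

text \<open>For the exponents (1, 0) the gradient term is absent and the weight is at most
  |y|.\<close>

lemma mollified_lipschitz:
  assumes f: "test_function UNIV f"
  obtains K where "0 \<le> K" "\<And>x y. \<bar>mollified f x - mollified f (x + y)\<bar> \<le> K * norm y"
proof -
  obtain K where K: "0 \<le> K" "\<And>x y. \<bar>pairing (increment 1 0 (translate x f) y)\<bar> \<le> K * weight 1 0 y"
    using abs_pairing_increment_le[OF f, of 1 0] by auto
  have "\<bar>mollified f x - mollified f (x + y)\<bar> \<le> K * norm y" for x y
  proof -
    have "\<bar>mollified f x - mollified f (x + y)\<bar> \<le> K * weight 1 0 y"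
      using K(2)[of x y] by (simp add: pairing_increment_eq[OF f] grad_cutoff_def cong: if_cong)
    also have "\<dots> \<le> K * norm y"
      using K(1) by (intro mult_left_mono) (auto simp: weight_def)
    finally show ?thesis .
  qed
  then show thesis using that K(1) by blast
qed

text \<open>For the exponents (2, 1) the gradient term is present for every y, and the weight is at
  most |y|^2, since |y| \<le> |y|^2 beyond the unit ball.\<close>

lemma mollified_taylor:
  assumes f: "test_function UNIV f"
  obtains K where "0 \<le> K"
    "\<And>x y. \<bar>mollified f x - mollified f (x + y) - mollified_grad f x y\<bar> \<le> K * (norm y)\<^sup>2"
proof -
  obtain K where K: "0 \<le> K" "\<And>x y. \<bar>pairing (increment 2 1 (translate x f) y)\<bar> \<le> K * weight 2 1 y"
    using abs_pairing_increment_le[OF f, of 2 1] by auto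
  have "\<bar>mollified f x - mollified f (x + y) - mollified_grad f x y\<bar> \<le> K * (norm y)\<^sup>2" for x y
  proof -
    have "\<bar>mollified f x - mollified f (x + y) - mollified_grad f x y\<bar> \<le> K * weight 2 1 y"
      using K(2)[of x y] by (simp add: pairing_increment_eq[OF f] grad_cutoff_def cong: if_cong)
    also have "\<dots> \<le> K * (norm y)\<^sup>2"
      using K(1) self_le_power[of "norm y" 2] by (intro mult_left_mono) (auto simp: weight_def)
    finally show ?thesis .
  qed
  then show thesis using that K(1) by blast
qed

end

section \<open>Propagation of the maximum\<close>

context liouville
begin

text \<open>Moving from X n by t y or by -t y cannot exceed M, so t |gradient| is at most the gap to
  M plus a term of order t^2. A small fixed t, followed by large n, makes the gradient
  small.\<close>

lemma near_max_grad_tendsto: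
  assumes f: "test_function UNIV f" and M: "\<And>x. mollified f x \<le> M"
    and X: "(\<lambda>n. mollified f (X n)) \<longlonglongrightarrow> M"
  shows "(\<lambda>n. mollified_grad f (X n) y) \<longlonglongrightarrow> 0"
proof (rule tendstoI)
  obtain K where K: "0 \<le> K"
    "\<And>x y. \<bar>mollified f x - mollified f (x + y) - mollified_grad f x y\<bar> \<le> K * (norm y)\<^sup>2"
    using mollified_taylor[OF f] by metis
  define \<delta> where "\<delta> n = M - mollified f (X n)" for n
  have \<delta>: "\<delta> \<longlonglongrightarrow> 0"
    unfolding \<delta>_def using tendsto_diff[OF tendsto_const[of M] X] by simp
  have one_sided: "- (t * mollified_grad f (X n) y) \<le> \<delta> n + K * (t\<^sup>2 * (norm y)\<^sup>2)" for n t
    using K(2)[of "X n" "t *\<^sub>R y"] M[of "X n + t *\<^sub>R y"]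
    by (simp add: \<delta>_def mollified_grad_scaleR[OF f] power_mult_distrib abs_le_iff)
  fix e :: real assume e: "0 < e"
  \<comment> \<open>The summand 1 keeps the denominator of t positive when K or y is 0; then t d =
    e/2 bounds the quadratic error after division by t.\<close>
  define d where "d = K * (norm y)\<^sup>2 + 1"
  have den: "0 < d" using K(1) unfolding d_def by (intro add_nonneg_pos) auto
  define t where "t = e / (2 * d)"
  have t: "0 < t" using e den by (simp add: t_def)
  have "t * d = e / 2" using den by (simp add: t_def)
  then have small: "K * (t * (norm y)\<^sup>2) < e / 2" using t by (simp add: d_def algebra_simps)
  have "eventually (\<lambda>n. \<delta> n < t * (e / 2)) sequentially"
    using t e by (intro order_tendstoD(2)[OF \<delta>]) simp
  then show "eventually (\<lambda>n. dist (mollified_grad f (X n) y) 0 < e) sequentially"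
  proof eventually_elim
    case (elim n)
    have "t * \<bar>mollified_grad f (X n) y\<bar> \<le> \<delta> n + K * (t\<^sup>2 * (norm y)\<^sup>2)"
      using one_sided[of t n] one_sided[of "- t" n] t by (cases "mollified_grad f (X n) y \<ge> 0") auto
    also have "\<dots> < t * (e / 2) + t * (e / 2)"
      using elim mult_strict_left_mono[OF small t] by (simp add: power2_eq_square mult_ac)
    finally have "t * \<bar>mollified_grad f (X n) y\<bar> < t * e" by (simp add: algebra_simps)
    then show ?case using t by simp
  qed
qed

lemma grad_cutoff_bounds: "0 \<le> grad_cutoff p' q' y" "grad_cutoff p' q' y \<le> 1"
  by (auto simp: grad_cutoff_def)

text \<open>The integral of the increments is the drift term, which vanishes in the limit, and their
  negative parts are dominated and tend to \<open>0\<close> pointwise because of the near-maximality.\<close>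

lemma near_max_increment_tendsto:
  assumes f: "test_function UNIV f" and M: "\<And>x. mollified f x \<le> M"
    and X: "(\<lambda>n. mollified f (X n)) \<longlonglongrightarrow> M"
  shows "(\<lambda>n. LINT y|N. \<bar>pairing (increment p q (translate (X n) f) y)\<bar>) \<longlonglongrightarrow> 0"
proof -
  define J where "J n y = pairing (increment p q (translate (X n) f) y)" for n y
  define m where "m n y = max 0 (- J n y)" for n y
  have [measurable]: "J n \<in> borel_measurable borel" for n
    unfolding J_def by (intro pairing_increment_measurable test_function_translate f)
  have [measurable]: "m n \<in> borel_measurable borel" for n
    unfolding m_def by measurable
  obtain K where K: "0 \<le> K" "\<And>x y. \<bar>pairing (increment p q (translate x f) y)\<bar> \<le> K * weight p q y"
    using abs_pairing_increment_le[OF f near_exp_cases far_exp_cases] by metis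
  then have JK: "\<bar>J n y\<bar> \<le> K * weight p q y" for n y by (simp add: J_def)
  have w: "integrable N (\<lambda>y. K * weight p q y)" using integrable_N_weight by simp
  have J_int: "integrable N (J n)" for n
    by (rule Bochner_Integration.integrable_bound[OF w])
      (auto intro!: AE_I2 order_trans[OF JK abs_ge_self])
  have mK: "\<bar>m n y\<bar> \<le> K * weight p q y" for n y
    using JK[of n y] by (auto simp: m_def)
  have m_int: "integrable N (m n)" for n
    by (rule Bochner_Integration.integrable_bound[OF w])
      (auto intro!: AE_I2 order_trans[OF mK abs_ge_self])
  have m_pt: "(\<lambda>n. m n y) \<longlonglongrightarrow> 0" for y
  proof (rule tendsto_sandwich[OF _ _ tendsto_const])
    have "(\<lambda>n. (M - mollified f (X n)) + \<bar>mollified_grad f (X n) y\<bar>) \<longlonglongrightarrow> (M - M) + \<bar>0\<bar>"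
      by (intro tendsto_intros X near_max_grad_tendsto[OF f M X])
    then show "(\<lambda>n. (M - mollified f (X n)) + \<bar>mollified_grad f (X n) y\<bar>) \<longlonglongrightarrow> 0" by simp
    \<comment> \<open>The value at X n + y is at most M, so a negative increment is controlled by
      the gap at X n and the gradient there.\<close>
    have "m n y \<le> (M - mollified f (X n)) + \<bar>mollified_grad f (X n) y\<bar>" for n
    proof -
      have "grad_cutoff p q y * mollified_grad f (X n) y \<le> 1 * \<bar>mollified_grad f (X n) y\<bar>"
        using grad_cutoff_bounds[of p q y]
        by (intro order_trans[OF mult_left_mono[OF abs_ge_self] mult_right_mono]) auto
      then show ?thesis
        using M[of "X n + y"] M[of "X n"] by (simp add: m_def J_def pairing_increment_eq[OF f])
    qed
    then show "eventually (\<lambda>n. m n y \<le> (M - mollified f (X n)) + \<bar>mollified_grad f (X n) y\<bar>) sequentially"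
      by simp
  qed (simp add: m_def)
  have m_lim: "(\<lambda>n. LINT y|N. m n y) \<longlonglongrightarrow> (LINT y|N. 0)"
    by (rule integral_dominated_convergence[where w = "\<lambda>y. K * weight p q y"])
      (use w m_pt mK in auto)
  have "(LINT y|N. J n y) = mollified_grad f (X n) b" for n
    unfolding J_def mollified_grad_def
    by (intro integral_pairing_increment test_function_translate f)
  then have "(\<lambda>n. (LINT y|N. J n y) + 2 * (LINT y|N. m n y)) \<longlonglongrightarrow> 0 + 2 * 0"
    using near_max_grad_tendsto[OF f M X, of b] m_lim by (intro tendsto_intros) auto
  \<comment> \<open>Since |J| = J + 2 m, the signed integral and the negative part together control
    the norm.\<close>
  moreover have "(LINT y|N. \<bar>J n y\<bar>) = (LINT y|N. J n y) + 2 * (LINT y|N. m n y)" for n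
  proof -
    have "(LINT y|N. \<bar>J n y\<bar>) = (LINT y|N. J n y + 2 * m n y)"
      by (intro Bochner_Integration.integral_cong) (auto simp: m_def max_def)
    then show ?thesis using J_int m_int by simp
  qed
  ultimately show ?thesis by (simp add: J_def)
qed

text \<open>Smallness of the increments in the integral norm says nothing about the single point a,
  which may be null. It is averaged over a ball around a, of positive mass, and the Lipschitz bound
  brings the estimate back to the centre.\<close>

lemma near_max_propagates:
  assumes f: "test_function UNIV f" and M: "\<And>x. mollified f x \<le> M"
    and X: "(\<lambda>n. mollified f (X n)) \<longlonglongrightarrow> M"
    and a: "a \<noteq> 0" "\<And>r. r > 0 \<Longrightarrow> emeasure N (ball a r) > 0"
  shows "(\<lambda>n. mollified f (X n + a)) \<longlonglongrightarrow> M"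
proof (rule tendstoI)
  fix e :: real assume e: "0 < e"
  obtain K where K: "0 \<le> K" "\<And>x y. \<bar>mollified f x - mollified f (x + y)\<bar> \<le> K * norm y"
    using mollified_lipschitz[OF f] by metis
  define J where "J n y = pairing (increment p q (translate (X n) f) y)" for n y
  have [measurable]: "J n \<in> borel_measurable borel" for n
    unfolding J_def by (intro pairing_increment_measurable test_function_translate f)
  obtain L where L: "0 \<le> L" "\<And>x y. \<bar>pairing (increment p q (translate x f) y)\<bar> \<le> L * weight p q y"
    using abs_pairing_increment_le[OF f near_exp_cases far_exp_cases] by metis
  have J_int: "integrable N (J n)" for n
  proof (rule Bochner_Integration.integrable_bound)
    show "integrable N (\<lambda>y. L * weight p q y)" using integrable_N_weight by simp
    show "AE y in N. norm (J n y) \<le> norm (L * weight p q y)"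
      by (auto simp: J_def intro!: AE_I2 order_trans[OF L(2) abs_ge_self])
  qed simp
  \<comment> \<open>The first bound keeps the ball away from the origin, so that its mass is finite;
    the second makes the Lipschitz error at most e/2, with K + 1 in place of K to avoid division by
    0.\<close>
  define r where "r = min (norm a / 2) (e / (2 * (K + 1)))"
  have r: "0 < r" using a e K(1) by (simp add: r_def)
  have "K * r \<le> (K + 1) * (e / (2 * (K + 1)))"
    using K(1) r by (intro mult_mono) (auto simp: r_def)
  also have "\<dots> = e / 2" using K(1) by (simp add: field_simps)
  finally have Kr: "K * r \<le> e / 2" .
  define V where "V = measure N (ball a r)"
  have "ball a r \<subseteq> {y. norm a / 3 < norm y}"
  proof
    fix y assume "y \<in> ball a r"
    then have "norm (a - y) < norm a / 2" by (simp add: r_def dist_norm)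
    moreover have "norm a \<le> norm (a - y) + norm y"
      using norm_triangle_ineq[of "a - y" y] by simp
    moreover have "0 < norm a" using a by simp
    ultimately show "y \<in> {y. norm a / 3 < norm y}" unfolding mem_Collect_eq by linarith
  qed
  then have "emeasure N (ball a r) \<le> emeasure N {y. norm a / 3 < norm y}"
    by (rule emeasure_mono) simp
  also have "\<dots> < \<infinity>" using a by (intro emeasure_kernel_measure_outside_finite) simp
  finally have fin: "emeasure N (ball a r) < \<infinity>" .
  then have V: "0 < V"
    using a(2)[OF r] by (simp add: V_def measure_def enn2real_positive_iff)
  \<comment> \<open>A bound for the gradient term that is uniform over the ball: only finitely many
    partial derivatives have to tend to 0.\<close>
  define \<gamma> where "\<gamma> n = (\<Sum>i\<in>Basis. \<bar>mollified_grad f (X n) i\<bar>)" for n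
  define R where "R n = (LINT y|N. \<bar>J n y\<bar>) / V + (M - mollified f (X n)) + (norm a + r) * \<gamma> n + K * r" for n
  have bound: "M - mollified f (X n + a) \<le> R n" for n
  proof -
    \<comment> \<open>A constant lower bound of |J n y| on the ball, namely the gap at X n + a minus
      all error terms. Averaging over the ball then bounds it by the integral divided by V; a
      negative c does no harm.\<close>
    define c where "c = M - mollified f (X n + a) - (M - mollified f (X n)) - (norm a + r) * \<gamma> n - K * r"
    have pt: "c \<le> \<bar>J n y\<bar>" if y: "y \<in> ball a r" for y
    proof -
      have ny: "norm y \<le> norm a + r" "norm (a - y) \<le> r"
        using y norm_triangle_ineq4[of a "a - y"] by (auto simp: dist_norm)
      have "mollified f (X n + y) - mollified f (X n + a) \<le> K * norm (a - y)"
        using K(2)[of "X n + y" "a - y"] by (simp add: algebra_simps)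
      also have "\<dots> \<le> K * r" using K(1) ny by (intro mult_left_mono)
      finally have 1: "mollified f (X n + y) - mollified f (X n + a) \<le> K * r" .
      have "grad_cutoff p q y * mollified_grad f (X n) y \<le> 1 * \<bar>mollified_grad f (X n) y\<bar>"
        using grad_cutoff_bounds[of p q y]
        by (intro order_trans[OF mult_left_mono[OF abs_ge_self] mult_right_mono]) auto
      also have "\<bar>mollified_grad f (X n) y\<bar> \<le> (\<Sum>i\<in>Basis. \<bar>(y \<bullet> i) * mollified_grad f (X n) i\<bar>)"
        by (subst mollified_grad_eq_sum[OF f]) (rule sum_abs)
      also have "\<dots> \<le> (\<Sum>i\<in>Basis. (norm a + r) * \<bar>mollified_grad f (X n) i\<bar>)"
        unfolding abs_mult using ny(1)
        by (intro sum_mono mult_right_mono) (auto intro: order_trans[OF Basis_le_norm])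
      finally have 2: "grad_cutoff p q y * mollified_grad f (X n) y \<le> (norm a + r) * \<gamma> n"
        by (simp add: \<gamma>_def sum_distrib_left)
      have "J n y = mollified f (X n) - mollified f (X n + y) - grad_cutoff p q y * mollified_grad f (X n) y"
        by (simp add: J_def pairing_increment_eq[OF f])
      then show ?thesis using 1 2 by (simp add: c_def)
    qed
    have "c * V = (LINT y|N. c * indicator (ball a r) y)"
      by (simp add: V_def)
    also have "\<dots> \<le> (LINT y|N. \<bar>J n y\<bar>)"
    proof (rule integral_mono)
      show "integrable N (\<lambda>y. c * indicator (ball a r) y)"
        using fin by (intro integrable_mult_right integrable_real_indicator) auto
      show "c * indicator (ball a r) y \<le> \<bar>J n y\<bar>" for y
        using pt[of y] by (cases "y \<in> ball a r") auto
    qed (use J_int in simp)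
    finally have "c \<le> (LINT y|N. \<bar>J n y\<bar>) / V" using V by (simp add: field_simps)
    then show ?thesis by (simp add: c_def R_def)
  qed
  have "\<gamma> \<longlonglongrightarrow> (\<Sum>i\<in>(Basis::'a set). \<bar>0\<bar>)"
    unfolding \<gamma>_def by (intro tendsto_intros near_max_grad_tendsto[OF f M X])
  then have "R \<longlonglongrightarrow> 0 / V + (M - M) + (norm a + r) * 0 + K * r"
    unfolding R_def using V near_max_increment_tendsto[OF f M X]
    by (intro tendsto_intros X) (auto simp: J_def)
  then have "eventually (\<lambda>n. R n < e) sequentially"
    using Kr e order_tendstoD(2)[of R "K * r" _ e] by simp
  then show "eventually (\<lambda>n. dist (mollified f (X n + a)) M < e) sequentially"
  proof eventually_elim
    case (elim n)
    then show ?case using bound[of n] M[of "X n + a"] by (simp add: dist_real_def)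
  qed
qed

text \<open>Along the iterates \<open>X n + k a\<close> the differences telescope; if their supremum were positive,
  the bounded function \<open>mollified f\<close> would have arbitrarily large oscillation.\<close>

lemma pairing_le_translate:
  assumes f: "test_function UNIV f"
    and a: "a \<noteq> 0" "\<And>r. r > 0 \<Longrightarrow> emeasure N (ball a r) > 0"
  shows "pairing f \<le> pairing (translate a f)"
proof -
  define g where "g w = f w - translate a f w" for w
  have g: "test_function UNIV g"
    unfolding g_def by (intro test_function_diff test_function_translate f)
  have g_eq: "mollified g x = mollified f x - mollified f (x + a)" for x
  proof -
    have "translate x g = (\<lambda>w. translate x f w - translate (x + a) f w)"
      by (simp add: fun_eq_iff g_def translate_def algebra_simps)
    then show ?thesis
      by (simp add: mollified_def pairing_diff integrable_test_function test_function_translate f)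
  qed
  obtain K where K: "\<And>x. \<bar>mollified f x\<bar> \<le> K"
    using mollified_bounded[OF f] by metis
  define M where "M = (SUP x. mollified g x)"
  have bdd: "bdd_above (range (mollified g))"
    using mollified_bounded[OF g] by (metis abs_le_D1 bdd_aboveI2)
  then have le_M: "mollified g x \<le> M" for x
    unfolding M_def by (intro cSUP_upper) auto
  have "\<exists>x. M - inverse (real (Suc n)) < mollified g x" for n
    using less_cSUP_iff[OF UNIV_not_empty bdd, of "M - inverse (real (Suc n))"]
    by (simp add: M_def[symmetric])
  then obtain X where X: "\<And>n. M - inverse (real (Suc n)) < mollified g (X n)" by metis
  have X_lim: "(\<lambda>n. mollified g (X n)) \<longlonglongrightarrow> M"
  proof (rule tendsto_sandwich[OF _ _ _ tendsto_const])
    show "(\<lambda>n. M - inverse (real (Suc n))) \<longlonglongrightarrow> M"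
      using tendsto_diff[OF tendsto_const[of M] LIMSEQ_inverse_real_of_nat] by simp
  qed (use X le_M in \<open>auto intro!: always_eventually less_imp_le simp del: of_nat_Suc\<close>)
  \<comment> \<open>The shifted points form a maximizing sequence again, which is the input that
    propagation needs.\<close>
  have iter: "(\<lambda>n. mollified g (X n + real k *\<^sub>R a)) \<longlonglongrightarrow> M" for k
  proof (induction k)
    case (Suc k)
    have eq: "X n + real (Suc k) *\<^sub>R a = X n + real k *\<^sub>R a + a" for n
      by (simp add: scaleR_left_distrib add_ac)
    show ?case
      unfolding eq by (rule near_max_propagates[OF g le_M Suc a])
  qed (use X_lim in simp)
  \<comment> \<open>The limit in n is taken for fixed m. As 2 K does not depend on m, a positive M
    would be contradicted by a large m.\<close>
  have "real m * M \<le> 2 * K" for m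
  proof (rule LIMSEQ_le_const2)
    show "(\<lambda>n. \<Sum>k<m. mollified g (X n + real k *\<^sub>R a)) \<longlonglongrightarrow> real m * M"
      using tendsto_sum[of "{..<m}" "\<lambda>k n. mollified g (X n + real k *\<^sub>R a)" "\<lambda>_. M"] iter by simp
    have "(\<Sum>k<m. mollified g (X n + real k *\<^sub>R a)) = mollified f (X n) - mollified f (X n + real m *\<^sub>R a)" for n
      by (induction m) (simp_all add: g_eq algebra_simps)
    then have "(\<Sum>k<m. mollified g (X n + real k *\<^sub>R a)) \<le> 2 * K" for n
      using K[of "X n"] K[of "X n + real m *\<^sub>R a"] by (simp add: abs_le_iff)
    then show "\<exists>N. \<forall>n\<ge>N. (\<Sum>k<m. mollified g (X n + real k *\<^sub>R a)) \<le> 2 * K" by blast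
  qed
  then have "M \<le> 0"
    by (metis reals_Archimedean3 linorder_not_le)
  then show ?thesis
    using le_M[of 0] unfolding g_eq by (simp add: mollified_def)
qed

text \<open>The inequality applied to -f is the reverse inequality for f.\<close>

lemma pairing_translate_support:
  assumes f: "test_function UNIV f"
    and a: "a \<noteq> 0" "\<And>r. r > 0 \<Longrightarrow> emeasure N (ball a r) > 0"
  shows "pairing (translate a f) = pairing f"
proof (rule antisym)
  have "translate a (\<lambda>w. - f w) = (\<lambda>w. - translate a f w)"
    by (simp add: fun_eq_iff translate_def)
  then show "pairing (translate a f) \<le> pairing f"
    using pairing_le_translate[OF test_function_uminus[OF f] a] by (simp add: pairing_uminus)
qed (rule pairing_le_translate[OF f a])

text \<open>Periods form a group. The support contributes whole rays and, with negatives, whole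
  lines; the directions of such lines form a subspace, and a nonzero vector orthogonal to it would
  contradict nondegeneracy.\<close>

lemma pairing_translate:
  assumes f: "test_function UNIV f"
    and nondegenerate: "\<And>v. norm v = 1 \<Longrightarrow> \<exists>\<theta>. norm \<theta> = 1 \<and> v \<bullet> \<theta> \<noteq> 0 \<and>
      (\<forall>r>0. emeasure \<kappa> (ball \<theta> r \<inter> sphere 0 1) > 0)"
  shows "pairing (translate a f) = pairing f"
proof -
  \<comment> \<open>The quantifier over all test functions makes periods composable, as a translate
    is another test function.\<close>
  define P where "P = {a. \<forall>f. test_function UNIV f \<longrightarrow> pairing (translate a f) = pairing f}"
  have P0: "0 \<in> P" by (simp add: P_def)
  have P_add: "x + y \<in> P" if "x \<in> P" "y \<in> P" for x y
  proof -
    have "pairing (translate x (translate y h)) = pairing h" if "test_function UNIV h" for h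
      using \<open>x \<in> P\<close> \<open>y \<in> P\<close> test_function_translate[OF that, of y] that unfolding P_def
      by (simp del: translate_translate)
    then show ?thesis by (simp add: P_def)
  qed
  have P_minus: "- x \<in> P" if "x \<in> P" for x
  proof -
    have "pairing (translate x (translate (- x) h)) = pairing (translate (- x) h)" if "test_function UNIV h" for h
      using \<open>x \<in> P\<close> test_function_translate[OF that, of "- x"] unfolding P_def by blast
    then show ?thesis by (simp add: P_def)
  qed
  \<comment> \<open>A group of periods need not be closed under scaling; retaining only the
    directions whose entire line consists of periods gives a linear subspace.\<close>
  define S where "S = {a. \<forall>t. t *\<^sub>R a \<in> P}"
  have "subspace S"
    by (rule subspaceI) (auto simp: S_def scaleR_add_right P0 P_add)
  have "span S = UNIV"
  proof (rule ccontr)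
    assume "span S \<noteq> UNIV"
    then obtain v where v: "v \<noteq> 0" "\<And>x. x \<in> span S \<Longrightarrow> v \<bullet> x = 0"
      using span_not_UNIV_orthogonal by blast
    obtain \<theta> where \<theta>: "norm \<theta> = 1" "v \<bullet> \<theta> \<noteq> 0" "\<And>r. r > 0 \<Longrightarrow> emeasure \<kappa> (ball \<theta> r \<inter> sphere 0 1) > 0"
      using nondegenerate[of "v /\<^sub>R norm v"] v(1) by auto
    have pos: "t *\<^sub>R \<theta> \<in> P" if t: "t > 0" for t
      unfolding P_def using t \<theta>(1)
      by (auto intro!: pairing_translate_support emeasure_kernel_measure_ball_pos[OF \<theta>(3)])
    have "t *\<^sub>R \<theta> \<in> P" for t
    proof -
      consider "t > 0" | "t = 0" | "t < 0" by linarith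
      then show ?thesis
      proof cases
        case 3
        then show ?thesis using P_minus[OF pos[of "- t"]] by simp
      qed (use pos P0 in auto)
    qed
    then have "\<theta> \<in> S" by (simp add: S_def)
    then show False using v(2) \<theta>(2) span_base by blast
  qed
  then have "a \<in> S" using \<open>subspace S\<close> by (metis UNIV_I span_eq_iff)
  then have "1 *\<^sub>R a \<in> P" unfolding S_def by blast
  then show ?thesis using f by (simp add: P_def)
qed

end

section \<open>Translation invariance\<close>

text \<open>Adding the constant C makes the density nonnegative. The measures with densities C + g
  and C agree on open boxes, a generator stable under intersection, so they coincide and their
  densities agree almost everywhere.\<close>

lemma AE_eq_0_if_box_integrals_0:
  fixes g :: "'a::euclidean_space \<Rightarrow> real"
  assumes [measurable]: "g \<in> borel_measurable borel" and C: "\<And>x. \<bar>g x\<bar> \<le> C"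
    and box: "\<And>l r. (\<And>i. i \<in> Basis \<Longrightarrow> l \<bullet> i \<le> r \<bullet> i) \<Longrightarrow> (LINT x|lborel. g x * indicator (box l r) x) = 0"
  shows "AE x in lborel. g x = 0"
proof -
  let ?E = "range (\<lambda>(a, b). box a b :: 'a set)"
  let ?A = "\<lambda>n::nat. box (- (real n *\<^sub>R One)) (real n *\<^sub>R One) :: 'a set"
  have nonneg: "0 \<le> C + g x" "0 \<le> C" for x using C[of x] by auto
  have int1: "integrable lborel (\<lambda>x. C * indicator (box l r) x)" for l r :: 'a
    by (intro integrable_mult_right integrable_real_indicator) (auto simp: emeasure_lborel_box_eq)
  have int2: "integrable lborel (\<lambda>x. g x * indicator (box l r) x)" for l r :: 'a
    by (rule Bochner_Integration.integrable_bound[OF int1[of l r]])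
      (auto intro!: AE_I2 simp: indicator_def intro: order_trans[OF C abs_ge_self])
  have eq: "density lborel (\<lambda>x. ennreal (C + g x)) = density lborel (\<lambda>_. ennreal C)"
  proof (rule measure_eqI_generator_eq)
    show "Int_stable ?E" by (auto simp: Int_stable_def box_Int_box)
    show "?E \<subseteq> Pow UNIV" by simp
    show "sets (density lborel (\<lambda>x. ennreal (C + g x))) = sigma_sets UNIV ?E"
      "sets (density lborel (\<lambda>_. ennreal C)) = sigma_sets UNIV ?E"
      by (simp_all add: borel_eq_box)
    show "range ?A \<subseteq> ?E" by auto
    show "(\<Union>i. ?A i) = UNIV" unfolding UN_box_eq_UNIV by auto
    have em1: "emeasure (density lborel (\<lambda>x. ennreal (C + g x))) (box l r)
      = ennreal (LINT x|lborel. C * indicator (box l r) x + g x * indicator (box l r) x)" for l r :: 'a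
    proof -
      have "emeasure (density lborel (\<lambda>x. ennreal (C + g x))) (box l r)
        = (\<integral>\<^sup>+x. ennreal (C * indicator (box l r) x + g x * indicator (box l r) x) \<partial>lborel)"
        by (subst emeasure_density) (auto intro!: nn_integral_cong simp: indicator_def)
      also have "\<dots> = ennreal (LINT x|lborel. C * indicator (box l r) x + g x * indicator (box l r) x)"
        using int1 int2 nonneg by (intro nn_integral_eq_integral) (auto intro!: AE_I2 simp: indicator_def)
      finally show ?thesis .
    qed
    show "emeasure (density lborel (\<lambda>x. ennreal (C + g x))) (?A i) \<noteq> \<infinity>" for i
      unfolding em1 by simp
    show "emeasure (density lborel (\<lambda>x. ennreal (C + g x))) X = emeasure (density lborel (\<lambda>_. ennreal C)) X"
      if X_in: "X \<in> ?E" for X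
    proof -
      obtain l r where X: "X = box l r" using X_in by auto
      show ?thesis
      \<comment> \<open>The hypothesis on box integrals speaks of ordered corners, which a nonempty
        box has.\<close>
      proof (cases "X = {}")
        case False
        then have "l \<bullet> i \<le> r \<bullet> i" if "i \<in> Basis" for i
          using that less_imp_le unfolding X box_ne_empty by blast
        then have "emeasure (density lborel (\<lambda>x. ennreal (C + g x))) X = ennreal (LINT x|lborel. C * indicator (box l r) x)"
          using int1 int2 box[of l r] unfolding X em1 by simp
        also have "\<dots> = (\<integral>\<^sup>+x. ennreal (C * indicator (box l r) x) \<partial>lborel)"
          using int1 nonneg(2) by (intro nn_integral_eq_integral[symmetric]) (auto intro!: AE_I2)
        also have "\<dots> = emeasure (density lborel (\<lambda>_. ennreal C)) X"
          unfolding X by (subst emeasure_density) (auto intro!: nn_integral_cong simp: indicator_def)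
        finally show ?thesis .
      qed simp
    qed
  qed
  have "AE x in lborel. ennreal (C + g x) = ennreal C"
    by (rule sigma_finite_measure.density_unique[OF lborel.sigma_finite_measure_axioms _ _ eq]) auto
  then show ?thesis
    by eventually_elim (use nonneg in simp)
qed

text \<open>The exceptional null set depends on a. Fubini's theorem exchanges the quantifiers and
  provides one point w at which u w = u (w + a) for almost every a; substituting z = w + a gives the
  constant u w.\<close>

lemma AE_eq_const_if_translation_invariant:
  fixes u :: "'a::euclidean_space \<Rightarrow> real"
  assumes [measurable]: "u \<in> borel_measurable borel"
    and trans: "\<And>a. AE w in lborel. u w = u (w + a)"
  shows "\<exists>c. AE w in lborel. u w = c"
proof -
  have meas: "{x \<in> space (lborel \<Otimes>\<^sub>M lborel). u (snd x) = u (snd x + fst x)} \<in> sets (lborel \<Otimes>\<^sub>M lborel)"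
    by measurable
  have "AE w in lborel. AE a in lborel. u w = u (w + a)"
    using lborel_pair.AE_commute[of "\<lambda>a w. u w = u (w + a)", OF meas] trans by simp
  then obtain w where w: "AE a in lborel. u w = u (w + a)"
    using eventually_happens'[of "ae_filter lborel"] by (auto simp: ae_filter_eq_bot_iff)
  have "AE z in distr lborel borel ((+) w). u w = u z"
    using w by (subst AE_distr_iff) auto
  then have "AE z in lborel. u z = u w"
    unfolding lborel_distr_plus by eventually_elim simp
  then show ?thesis by blast
qed

text \<open>Translation invariance of the pairing passes from the smooth bumps to box indicators by
  dominated convergence, so u and each of its translates have the same integral over every
  box.\<close>

lemma (in liouville) AE_const:
  assumes nondegenerate: "\<And>v. norm v = 1 \<Longrightarrow> \<exists>\<theta>. norm \<theta> = 1 \<and> v \<bullet> \<theta> \<noteq> 0 \<and>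
      (\<forall>r>0. emeasure \<kappa> (ball \<theta> r \<inter> sphere 0 1) > 0)"
  shows "\<exists>c. AE w in lborel. u w = c"
proof (rule AE_eq_const_if_translation_invariant[OF u_measurable])
  fix a :: 'a
  have box_int: "integrable lborel (indicator (box l r) :: 'a \<Rightarrow> real)" for l r
    by (intro integrable_real_indicator) (auto simp: emeasure_lborel_box_eq)
  have box_trans: "(LINT w|lborel. u w * indicator (box l r) (w - x)) = (LINT w|lborel. u w * indicator (box l r) w)"
    if lr: "\<And>i. i \<in> Basis \<Longrightarrow> l \<bullet> i \<le> r \<bullet> i" for l r x
  proof -
    have lim: "(\<lambda>n. pairing (translate y (box_bump l r n))) \<longlonglongrightarrow> (LINT w|lborel. u w * indicator (box l r) (w - y))" for y
      unfolding pairing_def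
    proof (rule integral_dominated_convergence[where w = "\<lambda>w. B * indicator (box l r) (w - y)"])
      show "integrable lborel (\<lambda>w. B * indicator (box l r) (w - y))"
        using box_int by (intro integrable_mult_right) (subst lborel_integral_translate, auto)
      show "AE w in lborel. (\<lambda>n. u w * translate y (box_bump l r n) w) \<longlonglongrightarrow> u w * indicator (box l r) (w - y)"
        using box_bump_tendsto[OF lr] by (intro AE_I2 tendsto_intros) (auto simp: translate_def)
      show "AE w in lborel. norm (u w * translate y (box_bump l r n) w) \<le> B * indicator (box l r) (w - y)" for n
        unfolding translate_def real_norm_def abs_mult
        by (intro AE_I2 mult_mono u_bounded abs_box_bump_le[OF lr] B_nonneg) auto
      have "translate y (box_bump l r n) \<in> borel_measurable borel" for n
        by (intro test_function_borel test_function_translate test_function_box_bump lr)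
      then show "(\<lambda>w. u w * translate y (box_bump l r n) w) \<in> borel_measurable lborel" for n
        by simp
      have "(\<lambda>w. indicator (box l r) (w - y) :: real) \<in> borel_measurable borel"
        by measurable
      then show "(\<lambda>w. u w * indicator (box l r) (w - y)) \<in> borel_measurable lborel"
        by simp
    qed
    have "pairing (translate x (box_bump l r n)) = pairing (translate 0 (box_bump l r n))" for n
      by (simp add: pairing_translate[OF test_function_box_bump[OF lr] nondegenerate])
    then show ?thesis
      using LIMSEQ_unique[OF lim[of x]] lim[of 0] by simp
  qed
  have ub: "integrable lborel (\<lambda>w. u w * indicator (box l r) w)" for l r
    by (intro integrable_u_mult box_int)
  have "AE w in lborel. u w - u (w + a) = 0"
  proof (rule AE_eq_0_if_box_integrals_0[where C = "2 * B"])
    show "\<bar>u w - u (w + a)\<bar> \<le> 2 * B" for w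
      using u_bounded[of w] u_bounded[of "w + a"] by linarith
    fix l r :: 'a assume lr: "\<And>i. i \<in> Basis \<Longrightarrow> l \<bullet> i \<le> r \<bullet> i"
    have [measurable]: "(\<lambda>w. u w * indicator (box l r) (w - a)) \<in> borel_measurable borel"
      by measurable
    \<comment> \<open>The integral of a translate of u over a box equals that of u over the box
      shifted by a.\<close>
    have "(\<lambda>w. u (w + a) * indicator (box l r) w) = (\<lambda>w. (\<lambda>w. u w * indicator (box l r) (w - a)) (w - (- a)))"
      by simp
    then have i: "integrable lborel (\<lambda>w. u (w + a) * indicator (box l r) w)"
      "(LINT w|lborel. u (w + a) * indicator (box l r) w) = (LINT w|lborel. u w * indicator (box l r) (w - a))"
      using lborel_integral_translate[of "\<lambda>w. u w * indicator (box l r) (w - a)" "- a"]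
        lborel_integral_translate(2)[of "indicator (box l r)" a] box_int[of l r]
        integrable_u_mult[of "\<lambda>w. indicator (box l r) (w - a)"]
      by (simp_all add: borel_measurable_indicator)
    show "(LINT w|lborel. (u w - u (w + a)) * indicator (box l r) w) = 0"
      using i ub[of l r] box_trans[OF lr, of a] by (simp add: left_diff_distrib)
  qed measurable
  then show "AE w in lborel. u w = u (w + a)" by simp
qed

text \<open>Borel measurability permits replacing Lebesgue measure by its Borel restriction in the
  weak equation.\<close>

lemma (in spherical_kernel) borel_measurable_adjoint_op:
  assumes f: "test_function UNIV f" and mean: "s = 1/2 \<longrightarrow> (LINT \<theta>|\<kappa>. \<theta>) = 0"
  shows "adjoint_op s \<kappa> b f \<in> borel_measurable borel"
proof -
  interpret N: sigma_finite_measure "kernel_measure s \<kappa>" by (rule sigma_finite_kernel_measure)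
  have [measurable]: "(\<lambda>x. increment (near_exp s) (far_exp s) f (snd x) (fst x)) \<in> borel_measurable (borel \<Otimes>\<^sub>M borel)"
    using measurable_compose[OF measurable_pair_swap' borel_measurable_increment_pair[OF f, of "near_exp s" "far_exp s"]]
    by (simp add: case_prod_beta)
  have [measurable]: "(\<lambda>w. frechet_derivative f (at w) v) \<in> borel_measurable borel" for v
    by (intro test_function_borel test_function_frechet_derivative f)
  have "(\<lambda>x. LINT y|kernel_measure s \<kappa>. increment (near_exp s) (far_exp s) f y x) \<in> borel_measurable borel"
    by (intro N.borel_measurable_lebesgue_integral) (simp add: case_prod_beta, measurable)
  moreover have "adjoint_op s \<kappa> b f = (\<lambda>x. (LINT y|kernel_measure s \<kappa>. increment (near_exp s) (far_exp s) f y x)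
      - frechet_derivative f (at x) (if s = 1/2 then b else 0))"
    by (intro ext adjoint_op_eq[OF f mean])
  ultimately show ?thesis by simp
qed

theorem theorem3p1:
  fixes s lam Lam :: real
    and \<kappa> :: "'a::euclidean_space measure"
    and b :: 'a
    and u :: "'a \<Rightarrow> real"
  assumes "0 < s" and "s < 1"
    and "0 < lam" and "lam \<le> Lam"
    and "admissible lam Lam s \<kappa> b"
    and "u \<in> borel_measurable lebesgue"
    and "\<exists>C. AE x in lebesgue. \<bar>u x\<bar> \<le> C"
    and "weak_solution s \<kappa> b UNIV (\<lambda>_. 0) u"
  shows "\<exists>c. AE x in lebesgue. u x = c"
proof -
  obtain C where C: "AE x in lborel. \<bar>u x\<bar> \<le> C"
    using assms(7) by (auto simp: AE_completion_iff)
  obtain u' where [measurable]: "u' \<in> borel_measurable borel" and u': "AE x in lborel. u x = u' x"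
    using completion_ex_borel_measurable_real[OF assms(6)] by auto
  \<comment> \<open>Truncation turns the almost everywhere bound into an everywhere bound without
    changing the class of u; the absolute value keeps the two levels in order.\<close>
  define v where "v x = max (- \<bar>C\<bar>) (min \<bar>C\<bar> (u' x))" for x
  have [measurable]: "v \<in> borel_measurable borel" unfolding v_def by measurable
  have uv: "AE x in lborel. u x = v x"
    using C u' by eventually_elim (auto simp: v_def)
  have mean: "s = 1/2 \<longrightarrow> (LINT \<theta>|\<kappa>. \<theta>) = 0"
    using assms(5) by (simp add: admissible_def)
  have kernel: "spherical_kernel s \<kappa>"
    using assms(1,5) by (simp add: admissible_def spherical_kernel_def)
  interpret spherical_kernel s \<kappa> by (rule kernel)
  \<comment> \<open>The drift is normalized as the locale demands; the adjoint is unchanged because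
    b enters only for s = 1/2.\<close>
  let ?b = "if s = 1/2 then b else 0"
  have weak: "(LINT w|lborel. v w * adjoint_op s \<kappa> ?b f w) = 0" if f: "test_function UNIV f" for f
  proof -
    have [measurable]: "adjoint_op s \<kappa> b f \<in> borel_measurable borel"
      by (rule borel_measurable_adjoint_op[OF f mean])
    have "adjoint_op s \<kappa> ?b f = adjoint_op s \<kappa> b f"
      by (simp add: fun_eq_iff adjoint_op_eq[OF f mean])
    then have "(LINT w|lborel. v w * adjoint_op s \<kappa> ?b f w) = (LINT w|lborel. v w * adjoint_op s \<kappa> b f w)"
      by simp
    also have "\<dots> = (LINT w|lebesgue. v w * adjoint_op s \<kappa> b f w)"
      by (intro integral_completion[symmetric]) simp
    also have "\<dots> = (LINT w|lebesgue. u w * adjoint_op s \<kappa> b f w)"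
    proof (rule integral_cong_AE)
      show "(\<lambda>w. v w * adjoint_op s \<kappa> b f w) \<in> borel_measurable lebesgue"
        by (intro measurable_completion) simp
      show "(\<lambda>w. u w * adjoint_op s \<kappa> b f w) \<in> borel_measurable lebesgue"
        by (intro borel_measurable_times[OF assms(6)] measurable_completion) simp
      have "AE w in lborel. v w * adjoint_op s \<kappa> b f w = u w * adjoint_op s \<kappa> b f w"
        using uv by eventually_elim simp
      then show "AE w in lebesgue. v w * adjoint_op s \<kappa> b f w = u w * adjoint_op s \<kappa> b f w"
        by (rule AE_completion)
    qed
    also have "\<dots> = 0"
      using assms(8) f by (simp add: weak_solution_def)
    finally show ?thesis .
  qed
  interpret liouville s \<kappa> v "\<bar>C\<bar>" ?b
    by unfold_locales (use assms(2) mean weak in \<open>auto simp: v_def\<close>)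
  have "\<exists>c. AE w in lborel. v w = c"
    using AE_const admissible_support_spanning[OF kernel assms(5,3)] by metis
  then obtain c where "AE w in lborel. v w = c" by blast
  with uv have "AE x in lborel. u x = c" by eventually_elim simp
  then show ?thesis using AE_completion by blast
qed

end
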